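(* There is a polynomial-time algorithm that, given a weighted house allocation instance $\langle N,H,V\rangle$ with $m\le n$, computes a complete allocation that minimizes the total envy among all complete allocations.
   Context: A house allocation instance $\langle N,H,V\rangle$ consists of a finite set $N$ of $n$ agents, a finite set $H$ of $m$ houses, and for each agent $i\in N$ a valuation $v_i:H\to\mathbb{R}_{\ge 0}$, with the convention $v_i(\emptyset)=0$. A weighted instance allows arbitrary non-negative values. An allocation $A$ assigns to each agent $i$ either one house $A(i)\in H$ or nothing ($A(i)=\emptyset$), with each house assigned to at most one agent; an agent may be assigned a house it values at zero. An allocation is complete if every agent is assigned a house (when $m\ge n$), or every house is assigned to an agent (when $m<n$). The total envy of $A$ is $\sum_{i\in N}\sum_{j\in N}\max\{v_i(A(j))-v_i(A(i)),0\}$. *)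

theory Defs
  imports Complex_Main "HOL-Library.Log_Nat" "HOL-Computational_Algebra.Polynomial"
begin

section \<open>House allocation\<close>

type_synonym ('a, 'h) allocation = "'a \<Rightarrow> 'h option"

text \<open>\<open>None\<close> is the empty assignment, which every agent values at zero.\<close>

definition bundle_value :: "('a \<Rightarrow> 'h \<Rightarrow> real) \<Rightarrow> 'a \<Rightarrow> 'h option \<Rightarrow> real" where
  "bundle_value v i x = (case x of None \<Rightarrow> 0 | Some h \<Rightarrow> v i h)"

definition is_allocation :: "'a set \<Rightarrow> 'h set \<Rightarrow> ('a, 'h) allocation \<Rightarrow> bool" where
  "is_allocation N H A \<longleftrightarrow>
     (\<forall>i\<in>N. \<forall>h. A i = Some h \<longrightarrow> h \<in> H) \<and>
     (\<forall>i\<in>N. \<forall>j\<in>N. \<forall>h. A i = Some h \<and> A j = Some h \<longrightarrow> i = j)"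

definition complete_allocation :: "'a set \<Rightarrow> 'h set \<Rightarrow> ('a, 'h) allocation \<Rightarrow> bool" where
  "complete_allocation N H A \<longleftrightarrow>
     is_allocation N H A \<and>
     (if card N \<le> card H then \<forall>i\<in>N. \<exists>h\<in>H. A i = Some h
      else \<forall>h\<in>H. \<exists>i\<in>N. A i = Some h)"

definition total_envy :: "'a set \<Rightarrow> ('a \<Rightarrow> 'h \<Rightarrow> real) \<Rightarrow> ('a, 'h) allocation \<Rightarrow> real" where
  "total_envy N v A =
     (\<Sum>i\<in>N. \<Sum>j\<in>N. max (bundle_value v i (A j) - bundle_value v i (A i)) 0)"


section \<open>The machine model\<close>

text \<open>
  Algorithms are programs of a structured random access machine.  The memory consists of
  named arrays of natural numbers (for control and addressing) and named arrays of values.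
  The only arithmetic is addition, (truncated) subtraction and comparison.  There is no
  multiplication, no rounding and no conversion between values and natural numbers.  Hence in \<open>T\<close>
  steps the natural numbers, and the integer coefficients with which the values depend on the input
  values, grow at most by a factor exponential in \<open>T\<close>, that is, by linearly many bits.
  This is what makes it sound to count every operation as one step.
\<close>

type_synonym vname = string

datatype nexp = NConst nat | NRead vname nexp | NPlus nexp nexp | NMinus nexp nexp

datatype vexp = VZero | VRead vname nexp | VPlus vexp vexp | VMinus vexp vexp

datatype bexp = NLess nexp nexp | VLess vexp vexp | BNot bexp | BAnd bexp bexp

datatype com =
    Skip
  | NAssign vname nexp nexp   \<comment> \<open>array, index, right-hand side\<close>
  | VAssign vname nexp vexp
  | Seq com com
  | Cond bexp com com
  | While bexp com

record state =
  nats :: "vname \<Rightarrow> nat \<Rightarrow> nat"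
  vals :: "vname \<Rightarrow> nat \<Rightarrow> real"

primrec nval :: "state \<Rightarrow> nexp \<Rightarrow> nat" where
  "nval s (NConst k) = k"
| "nval s (NRead x e) = nats s x (nval s e)"
| "nval s (NPlus e f) = nval s e + nval s f"
| "nval s (NMinus e f) = nval s e - nval s f"

primrec vval :: "state \<Rightarrow> vexp \<Rightarrow> real" where
  "vval s VZero = 0"
| "vval s (VRead x e) = vals s x (nval s e)"
| "vval s (VPlus e f) = vval s e + vval s f"
| "vval s (VMinus e f) = vval s e - vval s f"

primrec bval :: "state \<Rightarrow> bexp \<Rightarrow> bool" where
  "bval s (NLess e f) \<longleftrightarrow> nval s e < nval s f"
| "bval s (VLess e f) \<longleftrightarrow> vval s e < vval s f"
| "bval s (BNot b) \<longleftrightarrow> \<not> bval s b"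
| "bval s (BAnd b c) \<longleftrightarrow> bval s b \<and> bval s c"

text \<open>
  Every operation, including every constant and every memory access, is charged the size of the
  number it yields, as measured by \<open>\<nu>\<close> for natural numbers and by \<open>\<rho>\<close> for values.  As the operands and
  addresses are themselves results of subexpressions, their sizes are charged as well.
\<close>

primrec ncost :: "(nat \<Rightarrow> nat) \<Rightarrow> state \<Rightarrow> nexp \<Rightarrow> nat" where
  "ncost \<nu> s (NConst k) = \<nu> k"
| "ncost \<nu> s (NRead x e) = \<nu> (nval s (NRead x e)) + ncost \<nu> s e"
| "ncost \<nu> s (NPlus e f) = \<nu> (nval s (NPlus e f)) + ncost \<nu> s e + ncost \<nu> s f"
| "ncost \<nu> s (NMinus e f) = \<nu> (nval s (NMinus e f)) + ncost \<nu> s e + ncost \<nu> s f"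

primrec vcost :: "(nat \<Rightarrow> nat) \<Rightarrow> (real \<Rightarrow> nat) \<Rightarrow> state \<Rightarrow> vexp \<Rightarrow> nat" where
  "vcost \<nu> \<rho> s VZero = \<rho> 0"
| "vcost \<nu> \<rho> s (VRead x e) = \<rho> (vval s (VRead x e)) + ncost \<nu> s e"
| "vcost \<nu> \<rho> s (VPlus e f) = \<rho> (vval s (VPlus e f)) + vcost \<nu> \<rho> s e + vcost \<nu> \<rho> s f"
| "vcost \<nu> \<rho> s (VMinus e f) = \<rho> (vval s (VMinus e f)) + vcost \<nu> \<rho> s e + vcost \<nu> \<rho> s f"

primrec bcost :: "(nat \<Rightarrow> nat) \<Rightarrow> (real \<Rightarrow> nat) \<Rightarrow> state \<Rightarrow> bexp \<Rightarrow> nat" where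
  "bcost \<nu> \<rho> s (NLess e f) = 1 + ncost \<nu> s e + ncost \<nu> s f"
| "bcost \<nu> \<rho> s (VLess e f) = 1 + vcost \<nu> \<rho> s e + vcost \<nu> \<rho> s f"
| "bcost \<nu> \<rho> s (BNot b) = 1 + bcost \<nu> \<rho> s b"
| "bcost \<nu> \<rho> s (BAnd b c) = 1 + bcost \<nu> \<rho> s b + bcost \<nu> \<rho> s c"

definition nupdate :: "vname \<Rightarrow> nat \<Rightarrow> nat \<Rightarrow> state \<Rightarrow> state" where
  "nupdate x k a s = s\<lparr>nats := (nats s)(x := (nats s x)(k := a))\<rparr>"

definition vupdate :: "vname \<Rightarrow> nat \<Rightarrow> real \<Rightarrow> state \<Rightarrow> state" where
  "vupdate x k a s = s\<lparr>vals := (vals s)(x := (vals s x)(k := a))\<rparr>"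

text \<open>\<open>exec \<nu> \<rho> c s t s'\<close>: started in state \<open>s\<close>, program \<open>c\<close> halts in state \<open>s'\<close> after time \<open>t\<close>.\<close>

inductive exec :: "(nat \<Rightarrow> nat) \<Rightarrow> (real \<Rightarrow> nat) \<Rightarrow> com \<Rightarrow> state \<Rightarrow> nat \<Rightarrow> state \<Rightarrow> bool"
  for \<nu> :: "nat \<Rightarrow> nat" and \<rho> :: "real \<Rightarrow> nat" where
  exec_Skip: "exec \<nu> \<rho> Skip s 1 s"
| exec_NAssign: "exec \<nu> \<rho> (NAssign x e f) s (1 + ncost \<nu> s e + ncost \<nu> s f)
     (nupdate x (nval s e) (nval s f) s)"
| exec_VAssign: "exec \<nu> \<rho> (VAssign x e f) s (1 + ncost \<nu> s e + vcost \<nu> \<rho> s f)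
     (vupdate x (nval s e) (vval s f) s)"
| exec_Seq: "exec \<nu> \<rho> c s t s' \<Longrightarrow> exec \<nu> \<rho> d s' t' s'' \<Longrightarrow> exec \<nu> \<rho> (Seq c d) s (t + t') s''"
| exec_CondTrue: "bval s b \<Longrightarrow> exec \<nu> \<rho> c s t s' \<Longrightarrow>
     exec \<nu> \<rho> (Cond b c d) s (1 + bcost \<nu> \<rho> s b + t) s'"
| exec_CondFalse: "\<not> bval s b \<Longrightarrow> exec \<nu> \<rho> d s t s' \<Longrightarrow>
     exec \<nu> \<rho> (Cond b c d) s (1 + bcost \<nu> \<rho> s b + t) s'"
| exec_WhileFalse: "\<not> bval s b \<Longrightarrow> exec \<nu> \<rho> (While b c) s (1 + bcost \<nu> \<rho> s b) s"
| exec_WhileTrue: "bval s b \<Longrightarrow> exec \<nu> \<rho> c s t s' \<Longrightarrow> exec \<nu> \<rho> (While b c) s' t' s'' \<Longrightarrow>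
     exec \<nu> \<rho> (While b c) s (1 + bcost \<nu> \<rho> s b + t + t') s''"

inductive_cases exec_SkipE: "exec \<nu> \<rho> Skip s t s'"
inductive_cases exec_NAssignE: "exec \<nu> \<rho> (NAssign x e f) s t s'"
inductive_cases exec_VAssignE: "exec \<nu> \<rho> (VAssign x e f) s t s'"
inductive_cases exec_SeqE: "exec \<nu> \<rho> (Seq c d) s t s'"
inductive_cases exec_CondE: "exec \<nu> \<rho> (Cond b c d) s t s'"
inductive_cases exec_WhileE: "exec \<nu> \<rho> (While b c) s t s'"

lemma exec_deterministic:
  "exec \<nu> \<rho> c s t s' \<Longrightarrow> exec \<nu> \<rho> c s u s'' \<Longrightarrow> t = u \<and> s' = s''"
proof (induction arbitrary: u s'' rule: exec.induct)
  case (exec_Skip s)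
  then show ?case by (auto elim: exec_SkipE)
next
  case (exec_NAssign x e f s)
  then show ?case by (auto elim: exec_NAssignE)
next
  case (exec_VAssign x e f s)
  then show ?case by (auto elim: exec_VAssignE)
next
  case (exec_Seq c s t s' d t' s1)
  from exec_Seq.prems show ?case
    by (rule exec_SeqE) (metis exec_Seq.IH)
next
  case (exec_CondTrue s b c t s' d)
  from exec_CondTrue.prems show ?case
    by (rule exec_CondE) (metis exec_CondTrue.IH plus_1_eq_Suc add_Suc add_0, metis exec_CondTrue.hyps(1))
next
  case (exec_CondFalse s b d t s' c)
  from exec_CondFalse.prems show ?case
    by (rule exec_CondE) (metis exec_CondFalse.hyps(1), metis exec_CondFalse.IH plus_1_eq_Suc add_Suc add_0)
next
  case (exec_WhileFalse s b c)
  from exec_WhileFalse.prems show ?case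
    by (rule exec_WhileE) (simp, metis exec_WhileFalse.hyps(1))
next
  case (exec_WhileTrue s b c t s' t' s1)
  from exec_WhileTrue.prems show ?case
    by (rule exec_WhileE) (metis exec_WhileTrue.hyps(1), metis exec_WhileTrue.IH plus_1_eq_Suc add_Suc add_0)
qed


section \<open>Two measures of time\<close>

text \<open>
  For arbitrary real valuations, time is the number of elementary operations (the arithmetic
  model).
\<close>

definition arith_exec :: "com \<Rightarrow> state \<Rightarrow> nat \<Rightarrow> state \<Rightarrow> bool" where
  "arith_exec = exec (\<lambda>_. 1) (\<lambda>_. 1)"

text \<open>
  For rational valuations, written in binary as reduced fractions, every operation
  is charged the bit length of its result (the logarithmic cost criterion); this time is
  polynomially related to the running time of a Turing machine.  The size of an irrational number is irrelevant: a run on rational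
  valuations produces rational values only.
\<close>

definition nat_bits :: "nat \<Rightarrow> nat" where
  "nat_bits k = 1 + floorlog 2 k"

definition rat_bits :: "rat \<Rightarrow> nat" where
  "rat_bits r = (case quotient_of r of (a, b) \<Rightarrow> 1 + nat_bits (nat \<bar>a\<bar>) + nat_bits (nat b))"

definition real_bits :: "real \<Rightarrow> nat" where
  "real_bits x = rat_bits (inv (of_rat :: rat \<Rightarrow> real) x)"

definition bit_exec :: "com \<Rightarrow> state \<Rightarrow> nat \<Rightarrow> state \<Rightarrow> bool" where
  "bit_exec = exec nat_bits real_bits"


section \<open>Input and output\<close>

text \<open>
  In an encoded instance the agents are \<open>0, \<dots>, n - 1\<close> and the houses are \<open>0, \<dots>, m - 1\<close>.  The
  valuations are stored row by row, and all other memory cells are zero.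
\<close>

definition input_state :: "nat \<Rightarrow> nat \<Rightarrow> (nat \<Rightarrow> nat \<Rightarrow> real) \<Rightarrow> state" where
  "input_state n m v =
     \<lparr> nats = (\<lambda>x k. if x = ''n'' \<and> k = 0 then n else if x = ''m'' \<and> k = 0 then m else 0),
       vals = (\<lambda>x k. if x = ''v'' \<and> k < n * m then v (k div m) (k mod m) else 0) \<rparr>"

text \<open>In the output array, \<open>0\<close> stands for no house and \<open>h + 1\<close> for house \<open>h\<close>.\<close>

definition output_allocation :: "state \<Rightarrow> (nat, nat) allocation" where
  "output_allocation s i =
     (let k = nats s ''out'' i in if k = 0 then None else Some (k - 1))"

text \<open>Agents and houses are listed individually, so they contribute \<open>n + m\<close> and not just the bits
  of \<open>n\<close> and \<open>m\<close>.\<close>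

definition input_bits :: "nat \<Rightarrow> nat \<Rightarrow> (nat \<Rightarrow> nat \<Rightarrow> real) \<Rightarrow> nat" where
  "input_bits n m v = n + m + (\<Sum>i<n. \<Sum>h<m. real_bits (v i h))"

end

(* With all houses assigned, the total envy of A is a constant minus the weight of A, where giving
   house h to agent i has weight g i h = (SUM h'. min (v i h) (v i h')).  So the task is a maximum
   weight bipartite matching that covers the houses.  The Hungarian method solves it: the houses are
   inserted one at a time along an augmenting path of tight edges, while feasible potentials u (of
   houses) and w >= 0 (of agents, zero on unmatched agents) certify optimality by weak duality.

   All loops of the program are bounded by n or m, so its time in the arithmetic model is polynomial
   by induction on the syntax.  For rational inputs, every value stays an integer multiple of 1/D for
   a common denominator D of the input, and in t steps numerators and natural numbers gain at most t
   bits; hence t arithmetic steps take O(t (t + size of the input)) time under logarithmic cost. *)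

theory Submission
  imports Defs
begin

text \<open>Envy is additive only because every house is assigned: the envy of agent
  \<open>i\<close> then runs over all houses, whoever holds them, and depends on its own house alone
  through \<open>max (a - x) 0 = a - min x a\<close>. This is where \<open>m \<le> n\<close> enters;
  it also guarantees a free agent for each inserted house. In the duality bound \<open>u\<close> may
  have any sign because every competing allocation uses every house, whereas \<open>w\<close> must
  be nonnegative and vanish on agents without a house, because competitors may leave out different
  agents.

  The machine is a greater obstacle than the algorithm. Without multiplication, row addresses are
  tabulated by repeated addition; without an infinite value, a minimum needs a flag; without early
  exits, finished loops idle. In return a program denotes a total function \<open>run\<close>:
  correctness is proved about this function, and time is a matter of syntax. The passage to bit time
  works because the unit cost of an expression also bounds the number of bits by which its result
  can outgrow the memory.\<close>

declare One_nat_def [simp del]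

section \<open>Programs with bounded loops\<close>

datatype lcom =
    LSkip
  | LNat vname nexp nexp
  | LVal vname nexp vexp
  | LSeq lcom lcom
  | LCond bexp lcom lcom
  | LFor vname vname nat lcom  \<comment> \<open>counter, bound variable, constant added to the bound\<close>

primrec compile :: "lcom \<Rightarrow> com" where
  "compile LSkip = Skip"
| "compile (LNat x e f) = NAssign x e f"
| "compile (LVal x e f) = VAssign x e f"
| "compile (LSeq c d) = Seq (compile c) (compile d)"
| "compile (LCond b c d) = Cond b (compile c) (compile d)"
| "compile (LFor x b d c) =
     Seq (NAssign x (NConst 0) (NConst 0))
       (While (NLess (NRead x (NConst 0)) (NPlus (NRead b (NConst 0)) (NConst d)))
         (Seq (compile c) (NAssign x (NConst 0) (NPlus (NRead x (NConst 0)) (NConst 1)))))"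

primrec iterate :: "(nat \<Rightarrow> 'a \<Rightarrow> 'a) \<Rightarrow> nat \<Rightarrow> 'a \<Rightarrow> 'a" where
  "iterate f 0 a = a"
| "iterate f (Suc k) a = f k (iterate f k a)"

text \<open>A total semantics without a clock. The loop bound is evaluated once and the counter is
  set rather than incremented; this agrees with the compiled while loop as long as the body writes
  neither the counter nor the bound.\<close>

primrec run :: "lcom \<Rightarrow> state \<Rightarrow> state" where
  "run LSkip s = s"
| "run (LNat x e f) s = nupdate x (nval s e) (nval s f) s"
| "run (LVal x e f) s = vupdate x (nval s e) (vval s f) s"
| "run (LSeq c d) s = run d (run c s)"
| "run (LCond b c d) s = (if bval s b then run c s else run d s)"
| "run (LFor x b d c) s =
     iterate (\<lambda>k s. nupdate x 0 (Suc k) (run c s)) (nats s b 0 + d) (nupdate x 0 0 s)"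

primrec nwrites :: "lcom \<Rightarrow> vname set" where
  "nwrites LSkip = {}"
| "nwrites (LNat x e f) = {x}"
| "nwrites (LVal x e f) = {}"
| "nwrites (LSeq c d) = nwrites c \<union> nwrites d"
| "nwrites (LCond b c d) = nwrites c \<union> nwrites d"
| "nwrites (LFor x b d c) = insert x (nwrites c)"

primrec vwrites :: "lcom \<Rightarrow> vname set" where
  "vwrites LSkip = {}"
| "vwrites (LNat x e f) = {}"
| "vwrites (LVal x e f) = {x}"
| "vwrites (LSeq c d) = vwrites c \<union> vwrites d"
| "vwrites (LCond b c d) = vwrites c \<union> vwrites d"
| "vwrites (LFor x b d c) = vwrites c"

text \<open>Bounds are read only from the arrays that hold \<open>n\<close> and \<open>m\<close>. As
  long as these are never written, the number of iterations of any loop, however deeply nested, is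
  at most the size of the instance plus a constant.\<close>

primrec counters_ok :: "lcom \<Rightarrow> bool" where
  "counters_ok LSkip \<longleftrightarrow> True"
| "counters_ok (LNat x e f) \<longleftrightarrow> True"
| "counters_ok (LVal x e f) \<longleftrightarrow> True"
| "counters_ok (LSeq c d) \<longleftrightarrow> counters_ok c \<and> counters_ok d"
| "counters_ok (LCond b c d) \<longleftrightarrow> counters_ok c \<and> counters_ok d"
| "counters_ok (LFor x b d c) \<longleftrightarrow> counters_ok c \<and> x \<notin> nwrites c \<and> b \<in> {''n'', ''m''}"

lemma state_update_simps [simp]:
  "nats (nupdate x k a s) = (nats s)(x := (nats s x)(k := a))"
  "vals (nupdate x k a s) = vals s"
  "vals (vupdate x k r s) = (vals s)(x := (vals s x)(k := r))"
  "nats (vupdate x k r s) = nats s"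
  by (simp_all add: nupdate_def vupdate_def)

lemma iterate_invariant:
  assumes "I 0 a" "\<And>k a. k < N \<Longrightarrow> I k a \<Longrightarrow> I (Suc k) (f k a)"
  shows "I N (iterate f N a)"
proof -
  have "k \<le> N \<Longrightarrow> I k (iterate f k a)" for k
    by (induction k) (use assms in auto)
  then show ?thesis by simp
qed

lemma nats_run: "y \<notin> nwrites c \<Longrightarrow> nats (run c s) y = nats s y"
proof (induction c arbitrary: s)
  case (LFor x b d c)
  show ?case unfolding run.simps
    by (rule iterate_invariant[where I = "\<lambda>_ s'. nats s' y = nats s y"]) (use LFor in auto)
qed auto

lemma vals_run: "y \<notin> vwrites c \<Longrightarrow> vals (run c s) y = vals s y"
proof (induction c arbitrary: s)
  case (LFor x b d c)
  show ?case unfolding run.simps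
    by (rule iterate_invariant[where I = "\<lambda>_ s'. vals s' y = vals s y"]) (use LFor in auto)
qed auto

text \<open>The invariant rule for loops. It supplies the value of the counter and the unchanged
  arrays to the step case, so that invariants need to mention only what the loop computes.\<close>

lemma run_LFor:
  assumes "x \<notin> nwrites c" "N = nats s b 0 + d"
    and "I 0 (nupdate x 0 0 s)"
    and "\<And>k s'. k < N \<Longrightarrow> nats s' x 0 = k \<Longrightarrow>
      (\<And>y. y \<notin> insert x (nwrites c) \<Longrightarrow> nats s' y = nats s y) \<Longrightarrow>
      (\<And>y. y \<notin> vwrites c \<Longrightarrow> vals s' y = vals s y) \<Longrightarrow>
      I k s' \<Longrightarrow> I (Suc k) (nupdate x 0 (Suc k) (run c s'))"
  shows "I N (run (LFor x b d c) s)"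
proof -
  let ?J = "\<lambda>k s'. nats s' x 0 = k \<and> (\<forall>y. y \<notin> insert x (nwrites c) \<longrightarrow> nats s' y = nats s y) \<and>
      (\<forall>y. y \<notin> vwrites c \<longrightarrow> vals s' y = vals s y) \<and> I k s'"
  have "?J N (run (LFor x b d c) s)"
    unfolding run.simps assms(2)[symmetric]
  proof (rule iterate_invariant[where I = ?J])
    show "?J 0 (nupdate x 0 0 s)" using assms by auto
    fix k s' assume "k < N" "?J k s'"
    then show "?J (Suc k) (nupdate x 0 (Suc k) (run c s'))"
      using assms(4)[of k s'] by (auto simp: nats_run vals_run)
  qed
  then show ?thesis by blast
qed

section \<open>Arithmetic time of compiled programs\<close>

abbreviation unit_exec :: "com \<Rightarrow> state \<Rightarrow> nat \<Rightarrow> state \<Rightarrow> bool" where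
  "unit_exec \<equiv> exec (\<lambda>_. 1) (\<lambda>_. 1)"

text \<open>Under unit charges the time of an expression depends on its syntax only. Hence it may be
  evaluated in an arbitrary state, later \<open>undefined\<close>, to obtain a constant.\<close>

lemma unit_ncost: "ncost (\<lambda>_. 1) s e = ncost (\<lambda>_. 1) s' e"
  by (induction e) auto

lemma unit_vcost: "vcost (\<lambda>_. 1) (\<lambda>_. 1) s e = vcost (\<lambda>_. 1) (\<lambda>_. 1) s' e"
  by (induction e) (auto simp: unit_ncost[of s _ s'])

lemma unit_bcost: "bcost (\<lambda>_. 1) (\<lambda>_. 1) s e = bcost (\<lambda>_. 1) (\<lambda>_. 1) s' e"
  by (induction e) (auto simp: unit_ncost[of s _ s'] unit_vcost[of s _ s'])

text \<open>Coefficients are natural numbers, so every term is monotone.\<close>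

lemma nat_poly_mono: "(a :: nat) \<le> b \<Longrightarrow> poly p a \<le> poly p b"
  by (induction p) (auto intro!: mult_mono)

text \<open>The constants are generous: a test of the loop condition takes 8 steps, an increment 6
  and the initialisation 3. The bound \<open>K\<close> for the body is required only in states that
  a run of the loop can reach as far as unwritten arrays are concerned.\<close>

lemma compile_LFor_exec:
  assumes "x \<notin> nwrites c" "b \<notin> insert x (nwrites c)"
    and "\<And>s'. nats s' b 0 = nats s b 0 \<Longrightarrow>
      (\<And>y. y \<notin> insert x (nwrites c) \<Longrightarrow> nats s' y = nats s y) \<Longrightarrow>
      \<exists>t\<le>K. unit_exec (compile c) s' t (run c s')"
  shows "\<exists>t\<le>20 + (nats s b 0 + d) * (20 + K). unit_exec (compile (LFor x b d c)) s t (run (LFor x b d c) s)"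
proof -
  define N where "N = nats s b 0 + d"
  define w where "w = While (NLess (NRead x (NConst 0)) (NPlus (NRead b (NConst 0)) (NConst d)))
         (Seq (compile c) (NAssign x (NConst 0) (NPlus (NRead x (NConst 0)) (NConst 1))))"
  define f where "f = (\<lambda>k s. nupdate x 0 (Suc k) (run c s))"
  define S where "S = (\<lambda>k. iterate f k (nupdate x 0 0 s))"
  have S: "nats (S k) x 0 = k" "y \<notin> insert x (nwrites c) \<Longrightarrow> nats (S k) y = nats s y" for k y
    unfolding S_def
    by (induction k) (auto simp: f_def nats_run)
  \<comment> \<open>The induction is on the number \<open>j\<close> of remaining iterations:
    \<open>exec_WhileTrue\<close> peels off the first iteration, whereas \<open>iterate\<close>
    appends the last one.\<close>
  have "j \<le> N \<Longrightarrow> \<exists>t\<le>10 + j * (20 + K). unit_exec w (S (N - j)) t (S N)" for j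
  proof (induction j)
    case 0
    have "unit_exec w (S N) (1 + bcost (\<lambda>_. 1) (\<lambda>_. 1) (S N)
       (NLess (NRead x (NConst 0)) (NPlus (NRead b (NConst 0)) (NConst d)))) (S N)"
      unfolding w_def by (rule exec_WhileFalse) (use assms S in \<open>simp add: N_def\<close>)
    moreover have "1 + bcost (\<lambda>_. 1) (\<lambda>_. 1) (S N)
       (NLess (NRead x (NConst 0)) (NPlus (NRead b (NConst 0)) (NConst d))) \<le> 10 + 0 * (20 + K)" by simp
    ultimately show ?case by (metis diff_zero)
  next
    case (Suc j)
    then obtain t where t: "t \<le> 10 + j * (20 + K)" "unit_exec w (S (N - j)) t (S N)" by auto
    let ?k = "N - Suc j"
    obtain t1 where t1: "t1 \<le> K" "unit_exec (compile c) (S ?k) t1 (run c (S ?k))"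
      using assms(2) assms(3)[of "S ?k"] S by auto
    have eq: "S (N - j) = nupdate x 0 (Suc ?k) (run c (S ?k))"
    proof -
      have "N - j = Suc ?k" using Suc.prems by simp
      then show ?thesis by (simp add: S_def f_def)
    qed
    have "unit_exec (NAssign x (NConst 0) (NPlus (NRead x (NConst 0)) (NConst 1))) (run c (S ?k))
       (1 + ncost (\<lambda>_. 1) (run c (S ?k)) (NConst 0) + ncost (\<lambda>_. 1) (run c (S ?k)) (NPlus (NRead x (NConst 0)) (NConst 1))) (S (N - j))"
      using exec_NAssign[of "\<lambda>_. 1" "\<lambda>_. 1" x "NConst 0" "NPlus (NRead x (NConst 0)) (NConst 1)" "run c (S ?k)"]
      unfolding eq by (simp add: nats_run assms S Suc_eq_plus1)
    from exec_WhileTrue[OF _ exec_Seq[OF t1(2) this] t(2)[unfolded w_def]]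
    have "unit_exec w (S ?k) (1 + bcost (\<lambda>_. 1) (\<lambda>_. 1) (S ?k)
       (NLess (NRead x (NConst 0)) (NPlus (NRead b (NConst 0)) (NConst d))) + (t1 +
       (1 + ncost (\<lambda>_. 1) (run c (S ?k)) (NConst 0) + ncost (\<lambda>_. 1) (run c (S ?k)) (NPlus (NRead x (NConst 0)) (NConst 1)))) + t) (S N)"
      (is "unit_exec _ _ ?t _")
      unfolding w_def using assms S Suc.prems by (simp add: N_def)
    moreover have "?t \<le> 10 + Suc j * (20 + K)" using t(1) t1(1) by simp
    ultimately show ?case by blast
  qed
  from this[of N] obtain t where t: "t \<le> 10 + N * (20 + K)" "unit_exec w (S 0) t (S N)" by auto
  have "unit_exec (NAssign x (NConst 0) (NConst 0)) s 3 (S 0)"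
    using exec_NAssign[of "\<lambda>_. 1" "\<lambda>_. 1" x "NConst 0" "NConst 0" s] by (simp add: S_def numeral_eq_Suc)
  from exec_Seq[OF this t(2)] show ?thesis
    using t(1) by (intro exI[of _ "3 + t"]) (auto simp: w_def S_def f_def N_def)
qed

text \<open>Polynomials compose along the syntax: sequences and branches add them, a loop multiplies
  by \<open>d + N\<close>. The number \<open>N\<close> stays valid throughout because the arrays of
  \<open>n\<close> and \<open>m\<close> are not written.\<close>

lemma compile_exec:
  assumes "counters_ok c" "''n'' \<notin> nwrites c" "''m'' \<notin> nwrites c"
  shows "\<exists>P :: nat poly. \<forall>s N. nats s ''n'' 0 \<le> N \<longrightarrow> nats s ''m'' 0 \<le> N \<longrightarrow>
    (\<exists>t\<le>poly P N. unit_exec (compile c) s t (run c s))"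
  using assms
proof (induction c)
  case LSkip
  show ?case
  proof (intro exI[of _ "[:1:]"] allI impI)
    show "\<exists>t\<le>poly [:1:] N. unit_exec (compile LSkip) s t (run LSkip s)" for s N
      by (rule exI[of _ 1]) (simp add: exec_Skip)
  qed
next
  case (LNat x e f)
  define K where "K = 1 + ncost (\<lambda>_. 1) undefined e + ncost (\<lambda>_. 1) undefined f"
  have "unit_exec (compile (LNat x e f)) s K (run (LNat x e f) s)" for s
    using exec_NAssign[of "\<lambda>_. 1" "\<lambda>_. 1" x e f s]
    by (simp add: K_def unit_ncost[of undefined _ s])
  then show ?case by (intro exI[of _ "[:K:]"] allI impI exI[of _ K]) simp
next
  case (LVal x e f)
  define K where "K = 1 + ncost (\<lambda>_. 1) undefined e + vcost (\<lambda>_. 1) (\<lambda>_. 1) undefined f"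
  have "unit_exec (compile (LVal x e f)) s K (run (LVal x e f) s)" for s
    using exec_VAssign[of "\<lambda>_. 1" "\<lambda>_. 1" x e f s]
    by (simp add: K_def unit_ncost[of undefined _ s] unit_vcost[of undefined _ s])
  then show ?case by (intro exI[of _ "[:K:]"] allI impI exI[of _ K]) simp
next
  case (LSeq c d)
  then obtain P Q where PQ:
    "\<forall>s N. nats s ''n'' 0 \<le> N \<longrightarrow> nats s ''m'' 0 \<le> N \<longrightarrow> (\<exists>t\<le>poly P N. unit_exec (compile c) s t (run c s))"
    "\<forall>s N. nats s ''n'' 0 \<le> N \<longrightarrow> nats s ''m'' 0 \<le> N \<longrightarrow> (\<exists>t\<le>poly Q N. unit_exec (compile d) s t (run d s))"
    by auto
  have "\<exists>t\<le>poly (P + Q) N. unit_exec (compile (LSeq c d)) s t (run (LSeq c d) s)"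
    if N: "nats s ''n'' 0 \<le> N" "nats s ''m'' 0 \<le> N" for s N
  proof -
    obtain t where "t \<le> poly P N" "unit_exec (compile c) s t (run c s)" using PQ(1)[rule_format, OF N] by auto
    moreover obtain t' where "t' \<le> poly Q N" "unit_exec (compile d) (run c s) t' (run d (run c s))"
      using PQ(2)[rule_format, of "run c s" N] N LSeq.prems by (auto simp: nats_run)
    ultimately show ?thesis by (intro exI[of _ "t + t'"]) (auto intro!: exec_Seq)
  qed
  then show ?case by blast
next
  case (LCond b c d)
  then obtain P Q where PQ:
    "\<forall>s N. nats s ''n'' 0 \<le> N \<longrightarrow> nats s ''m'' 0 \<le> N \<longrightarrow> (\<exists>t\<le>poly P N. unit_exec (compile c) s t (run c s))"
    "\<forall>s N. nats s ''n'' 0 \<le> N \<longrightarrow> nats s ''m'' 0 \<le> N \<longrightarrow> (\<exists>t\<le>poly Q N. unit_exec (compile d) s t (run d s))"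
    by auto
  define K where "K = bcost (\<lambda>_. 1) (\<lambda>_. 1) undefined b"
  have K: "bcost (\<lambda>_. 1) (\<lambda>_. 1) s b = K" for s unfolding K_def by (rule unit_bcost)
  have "\<exists>t\<le>poly ([:1 + K:] + P + Q) N. unit_exec (compile (LCond b c d)) s t (run (LCond b c d) s)"
    if N: "nats s ''n'' 0 \<le> N" "nats s ''m'' 0 \<le> N" for s N
  proof (cases "bval s b")
    case True
    obtain t where t: "t \<le> poly P N" "unit_exec (compile c) s t (run c s)" using PQ(1)[rule_format, OF N] by auto
    show ?thesis using exec_CondTrue[OF True t(2), of "compile d"] True t(1)
      by (intro exI[of _ "1 + K + t"]) (auto simp: K)
  next
    case False
    obtain t where t: "t \<le> poly Q N" "unit_exec (compile d) s t (run d s)" using PQ(2)[rule_format, OF N] by auto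
    show ?thesis using exec_CondFalse[OF False t(2), of "compile c"] False t(1)
      by (intro exI[of _ "1 + K + t"]) (auto simp: K)
  qed
  then show ?case by blast
next
  case (LFor x b d c)
  then obtain P where P:
    "\<forall>s N. nats s ''n'' 0 \<le> N \<longrightarrow> nats s ''m'' 0 \<le> N \<longrightarrow> (\<exists>t\<le>poly P N. unit_exec (compile c) s t (run c s))"
    by auto
  have "\<exists>t\<le>poly ([:20:] + [:d, 1:] * ([:20:] + P)) N.
      unit_exec (compile (LFor x b d c)) s t (run (LFor x b d c) s)"
    if N: "nats s ''n'' 0 \<le> N" "nats s ''m'' 0 \<le> N" for s N
  proof -
    have b: "b \<notin> insert x (nwrites c)" "nats s b 0 \<le> N" using LFor.prems N by auto
    have "\<exists>t\<le>20 + (nats s b 0 + d) * (20 + poly P N).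
        unit_exec (compile (LFor x b d c)) s t (run (LFor x b d c) s)"
    proof (rule compile_LFor_exec)
      fix s' :: state assume "\<And>y. y \<notin> insert x (nwrites c) \<Longrightarrow> nats s' y = nats s y"
      then have "nats s' ''n'' = nats s ''n''" "nats s' ''m'' = nats s ''m''" using LFor.prems by auto
      then show "\<exists>t\<le>poly P N. unit_exec (compile c) s' t (run c s')" using P N by simp
    qed (use b(1) LFor.prems in auto)
    moreover have "(nats s b 0 + d) * (20 + poly P N) \<le> (d + N) * (20 + poly P N)"
      using b(2) by (intro mult_right_mono) auto
    then have "20 + (nats s b 0 + d) * (20 + poly P N) \<le> poly ([:20:] + [:d, 1:] * ([:20:] + P)) N"
      by (simp add: distrib_right)
    ultimately show ?thesis by (meson le_trans)
  qed
  then show ?case by blast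
qed

section \<open>From arithmetic time to bit time\<close>

text \<open>\<open>D\<close> is a common denominator, so subsequent sums and differences never enlarge it.\<close>

definition represented :: "nat \<Rightarrow> nat \<Rightarrow> real \<Rightarrow> bool" where
  "represented D B x \<longleftrightarrow> (\<exists>z::int. x * real D = real_of_int z \<and> \<bar>z\<bar> \<le> 2 ^ B)"

definition state_bound :: "nat \<Rightarrow> nat \<Rightarrow> state \<Rightarrow> bool" where
  "state_bound D B s \<longleftrightarrow> (\<forall>x k. nats s x k < 2 ^ B) \<and> (\<forall>x k. represented D B (vals s x k))"

text \<open>Only the constants occurring in the program are bounded: apart from the memory, they are
  the one source of numbers.\<close>

primrec nexp_bound :: "nat \<Rightarrow> nexp \<Rightarrow> bool" where
  "nexp_bound B (NConst k) \<longleftrightarrow> k < 2 ^ B"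
| "nexp_bound B (NRead x e) \<longleftrightarrow> nexp_bound B e"
| "nexp_bound B (NPlus e f) \<longleftrightarrow> nexp_bound B e \<and> nexp_bound B f"
| "nexp_bound B (NMinus e f) \<longleftrightarrow> nexp_bound B e \<and> nexp_bound B f"

primrec vexp_bound :: "nat \<Rightarrow> vexp \<Rightarrow> bool" where
  "vexp_bound B VZero \<longleftrightarrow> True"
| "vexp_bound B (VRead x e) \<longleftrightarrow> nexp_bound B e"
| "vexp_bound B (VPlus e f) \<longleftrightarrow> vexp_bound B e \<and> vexp_bound B f"
| "vexp_bound B (VMinus e f) \<longleftrightarrow> vexp_bound B e \<and> vexp_bound B f"

primrec bexp_bound :: "nat \<Rightarrow> bexp \<Rightarrow> bool" where
  "bexp_bound B (NLess e f) \<longleftrightarrow> nexp_bound B e \<and> nexp_bound B f"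
| "bexp_bound B (VLess e f) \<longleftrightarrow> vexp_bound B e \<and> vexp_bound B f"
| "bexp_bound B (BNot b) \<longleftrightarrow> bexp_bound B b"
| "bexp_bound B (BAnd b c) \<longleftrightarrow> bexp_bound B b \<and> bexp_bound B c"

primrec com_bound :: "nat \<Rightarrow> com \<Rightarrow> bool" where
  "com_bound B Skip \<longleftrightarrow> True"
| "com_bound B (NAssign x e f) \<longleftrightarrow> nexp_bound B e \<and> nexp_bound B f"
| "com_bound B (VAssign x e f) \<longleftrightarrow> nexp_bound B e \<and> vexp_bound B f"
| "com_bound B (Seq c d) \<longleftrightarrow> com_bound B c \<and> com_bound B d"
| "com_bound B (Cond b c d) \<longleftrightarrow> bexp_bound B b \<and> com_bound B c \<and> com_bound B d"
| "com_bound B (While b c) \<longleftrightarrow> bexp_bound B b \<and> com_bound B c"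

lemma less_power2_mono: "(x::nat) < 2 ^ A \<Longrightarrow> A \<le> B \<Longrightarrow> x < 2 ^ B"
  by (meson less_le_trans one_le_numeral power_increasing)

lemma nexp_bound_mono: "nexp_bound A e \<Longrightarrow> A \<le> B \<Longrightarrow> nexp_bound B e"
  by (induction e) (auto simp: less_power2_mono)

lemma vexp_bound_mono: "vexp_bound A e \<Longrightarrow> A \<le> B \<Longrightarrow> vexp_bound B e"
  by (induction e) (auto intro: nexp_bound_mono)

lemma bexp_bound_mono: "bexp_bound A e \<Longrightarrow> A \<le> B \<Longrightarrow> bexp_bound B e"
  by (induction e) (auto intro: nexp_bound_mono vexp_bound_mono)

lemma com_bound_mono: "com_bound A c \<Longrightarrow> A \<le> B \<Longrightarrow> com_bound B c"
  by (induction c) (auto intro: nexp_bound_mono vexp_bound_mono bexp_bound_mono)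

lemma com_bound_exists: "\<exists>B. com_bound B c"
proof -
  have n: "\<exists>B. nexp_bound B e" for e
  proof (induction e)
    case (NConst k)
    show ?case by (intro exI[of _ k]) simp
  next
    case (NPlus e f)
    then obtain A B where "nexp_bound A e" "nexp_bound B f" by auto
    then show ?case by (intro exI[of _ "max A B"]) (auto intro: nexp_bound_mono)
  next
    case (NMinus e f)
    then obtain A B where "nexp_bound A e" "nexp_bound B f" by auto
    then show ?case by (intro exI[of _ "max A B"]) (auto intro: nexp_bound_mono)
  qed auto
  have v: "\<exists>B. vexp_bound B e" for e
  proof (induction e)
    case (VPlus e f)
    then obtain A B where "vexp_bound A e" "vexp_bound B f" by auto
    then show ?case by (intro exI[of _ "max A B"]) (auto intro: vexp_bound_mono)
  next
    case (VMinus e f)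
    then obtain A B where "vexp_bound A e" "vexp_bound B f" by auto
    then show ?case by (intro exI[of _ "max A B"]) (auto intro: vexp_bound_mono)
  qed (auto simp: n)
  have b: "\<exists>B. bexp_bound B e" for e
  proof (induction e)
    case (NLess e f)
    obtain A B where "nexp_bound A e" "nexp_bound B f" using n by blast
    then show ?case by (intro exI[of _ "max A B"]) (auto intro: nexp_bound_mono)
  next
    case (VLess e f)
    obtain A B where "vexp_bound A e" "vexp_bound B f" using v by blast
    then show ?case by (intro exI[of _ "max A B"]) (auto intro: vexp_bound_mono)
  next
    case (BAnd e f)
    then obtain A B where "bexp_bound A e" "bexp_bound B f" by auto
    then show ?case by (intro exI[of _ "max A B"]) (auto intro: bexp_bound_mono)
  qed auto
  show ?thesis
  proof (induction c)
    case (NAssign x e f)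
    obtain A B where "nexp_bound A e" "nexp_bound B f" using n by blast
    then show ?case by (intro exI[of _ "max A B"]) (auto intro: nexp_bound_mono)
  next
    case (VAssign x e f)
    obtain A B where "nexp_bound A e" "vexp_bound B f" using n v by blast
    then show ?case by (intro exI[of _ "max A B"]) (auto intro: nexp_bound_mono vexp_bound_mono)
  next
    case (Seq c d)
    then obtain A B where "com_bound A c" "com_bound B d" by auto
    then show ?case by (intro exI[of _ "max A B"]) (auto intro: com_bound_mono)
  next
    case (Cond e c d)
    then obtain A B C where "com_bound A c" "com_bound B d" "bexp_bound C e" using b by blast
    then show ?case by (intro exI[of _ "max A (max B C)"]) (auto intro: com_bound_mono bexp_bound_mono)
  next
    case (While e c)
    then obtain A C where "com_bound A c" "bexp_bound C e" using b by blast
    then show ?case by (intro exI[of _ "max A C"]) (auto intro: com_bound_mono bexp_bound_mono)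
  qed auto
qed

section \<open>Growth of numbers and the price of an operation\<close>

lemma represented_mono: "represented D A x \<Longrightarrow> A \<le> B \<Longrightarrow> represented D B x"
  unfolding represented_def by (meson order_trans one_le_numeral power_increasing)

lemma state_bound_mono: "state_bound D A s \<Longrightarrow> A \<le> B \<Longrightarrow> state_bound D B s"
  unfolding state_bound_def by (meson represented_mono less_power2_mono)

text \<open>The exponent copies the unit cost of a sum, one step plus the costs of both operands.
  The larger of \<open>A\<close> and \<open>B\<close> plus one would do, but in this form cost and
  size obey the same recursion.\<close>

lemma power2_add_le: "2 ^ A + 2 ^ B \<le> (2 :: 'a :: linordered_semidom) ^ Suc (A + B)"
proof -
  have "(2::'a) ^ A \<le> 2 ^ (A + B)" "(2::'a) ^ B \<le> 2 ^ (A + B)" by (auto intro: power_increasing)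
  then have "(2::'a) ^ A + 2 ^ B \<le> 2 ^ (A + B) + 2 ^ (A + B)" by (rule add_mono)
  then show ?thesis by (simp only: power_Suc mult_2)
qed

lemma represented_add:
  assumes "represented D (B + a) x" "represented D (B + b) y"
  shows "represented D (B + Suc (a + b)) (x + y)" "represented D (B + Suc (a + b)) (x - y)"
proof -
  obtain p q :: int where pq: "x * real D = p" "\<bar>p\<bar> \<le> 2 ^ (B + a)" "y * real D = q" "\<bar>q\<bar> \<le> 2 ^ (B + b)"
    using assms by (auto simp: represented_def)
  have "(2::int) ^ (B + a) + 2 ^ (B + b) = 2 ^ B * (2 ^ a + 2 ^ b)" by (simp add: power_add algebra_simps)
  also have "\<dots> \<le> 2 ^ B * 2 ^ Suc (a + b)" by (intro mult_left_mono power2_add_le) auto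
  finally have le: "\<bar>p\<bar> + \<bar>q\<bar> \<le> 2 ^ (B + Suc (a + b))" using pq by (simp add: power_add)
  show "represented D (B + Suc (a + b)) (x + y)"
    unfolding represented_def by (intro exI[of _ "p + q"]) (use le pq in \<open>auto simp: algebra_simps\<close>)
  show "represented D (B + Suc (a + b)) (x - y)"
    unfolding represented_def by (intro exI[of _ "p - q"]) (use le pq in \<open>auto simp: algebra_simps\<close>)
qed

text \<open>A unit of time pays for an additional bit: a sum is at most twice its larger operand, a
  truncated difference does not exceed its first operand, and a read is bounded by the memory
  whatever its address.\<close>

lemma nval_bound:
  assumes "state_bound D B s" "nexp_bound B e"
  shows "nval s e < 2 ^ (B + ncost (\<lambda>_. 1) s e)"
  using assms(2)
proof (induction e)
  case (NConst k)
  then have "k < 2 ^ B" by simp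
  then show ?case unfolding nval.simps by (rule less_power2_mono) simp
next
  case (NRead x e)
  have "nats s x (nval s e) < 2 ^ B" using assms(1) by (simp add: state_bound_def)
  then show ?case unfolding nval.simps by (rule less_power2_mono) simp
next
  case (NPlus e f)
  let ?a = "ncost (\<lambda>_. 1) s e" and ?b = "ncost (\<lambda>_. 1) s f"
  have "nval s e + nval s f < 2 ^ (B + ?a) + 2 ^ (B + ?b)" using NPlus by (intro add_strict_mono) auto
  also have "\<dots> = 2 ^ B * (2 ^ ?a + 2 ^ ?b)" by (simp add: power_add algebra_simps)
  also have "\<dots> \<le> 2 ^ B * 2 ^ Suc (?a + ?b)" by (intro mult_left_mono power2_add_le) auto
  finally show ?case by (simp add: power_add)
next
  case (NMinus e f)
  have "nval s e - nval s f \<le> nval s e" by simp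
  also have "\<dots> < 2 ^ (B + ncost (\<lambda>_. 1) s e)" using NMinus by simp
  finally show ?case unfolding nval.simps by (rule less_power2_mono) simp
qed

lemma vval_bound:
  assumes "state_bound D B s"
  shows "represented D (B + vcost (\<lambda>_. 1) (\<lambda>_. 1) s e) (vval s e)"
proof (induction e)
  case VZero
  show ?case by (auto simp: represented_def intro!: exI[of _ 0])
next
  case (VRead x e)
  have "represented D B (vals s x (nval s e))" using assms by (simp add: state_bound_def)
  then show ?case unfolding vval.simps by (rule represented_mono) simp
next
  case (VPlus e f)
  then have "represented D (B + Suc (vcost (\<lambda>_. 1) (\<lambda>_. 1) s e + vcost (\<lambda>_. 1) (\<lambda>_. 1) s f)) (vval s e + vval s f)"
    by (rule represented_add)
  then show ?case by (simp add: add.assoc Suc_eq_plus1 add.commute add.left_commute)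
next
  case (VMinus e f)
  then have "represented D (B + Suc (vcost (\<lambda>_. 1) (\<lambda>_. 1) s e + vcost (\<lambda>_. 1) (\<lambda>_. 1) s f)) (vval s e - vval s f)"
    by (rule represented_add)
  then show ?case by (simp add: add.assoc Suc_eq_plus1 add.commute add.left_commute)
qed

lemma nat_bits_le: "k < 2 ^ M \<Longrightarrow> nat_bits k \<le> 1 + M"
  by (simp add: nat_bits_def floorlog_le_iff)

text \<open>Reducing the fraction \<open>z / D\<close> does not enlarge it: by coprimality the
  reduced denominator divides \<open>D\<close> and the reduced numerator divides \<open>z\<close>.
  As \<open>nat_bits_le\<close> needs strict bounds, both parts are compared with
  \<open>2 ^ Suc M\<close>, which gives \<open>1 + 2 * (M + 2) = 2 * M + 5\<close>.\<close>

lemma real_bits_le: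
  assumes "represented D M x" "D < 2 ^ Suc M" "0 < D"
  shows "real_bits x \<le> 2 * M + 5"
proof -
  obtain z :: int where z: "x * real D = z" "\<bar>z\<bar> \<le> 2 ^ M" using assms(1) by (auto simp: represented_def)
  define r where "r = Rat.Fract z (int D)"
  have "x = of_rat r" using z(1) assms(3) by (simp add: r_def of_rat_rat field_simps)
  then have inv: "inv (of_rat :: rat \<Rightarrow> real) x = r" by (simp add: inv_f_f inj_on_def)
  obtain a b where q: "quotient_of r = (a, b)" by fastforce
  have b: "b > 0" "coprime a b" "r = Rat.Fract a b" using q quotient_of_denom_pos quotient_of_coprime
      quotient_of_div[OF q] by (auto simp: Fract_of_int_quotient)
  have eq: "a * int D = z * b" using b(1,3) assms(3) by (simp add: r_def eq_rat)
  have "b dvd int D" using eq b(2) by (metis coprime_commute coprime_dvd_mult_right_iff dvd_triv_right)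
  then have "b \<le> int D" using assms(3) by (intro zdvd_imp_le) auto
  then have b2: "nat b < 2 ^ Suc M" using assms(2) by linarith
  have "a dvd z" using eq b(2) by (metis coprime_dvd_mult_left_iff dvd_triv_left)
  then have "\<bar>a\<bar> \<le> \<bar>z\<bar>"
  proof (cases "z = 0")
    case True
    then have "a = 0" using eq assms(3) by simp
    then show ?thesis by simp
  qed (use \<open>a dvd z\<close> dvd_imp_le_int in auto)
  then have "int (nat \<bar>a\<bar>) \<le> 2 ^ M" using z by simp
  also have "(2::int) ^ M < 2 ^ Suc M" by simp
  finally have "int (nat \<bar>a\<bar>) < int (2 ^ Suc M)" by simp
  then have a2: "nat \<bar>a\<bar> < 2 ^ Suc M" by (simp only: of_nat_less_iff)
  show ?thesis
    using nat_bits_le[OF a2] nat_bits_le[OF b2] by (simp add: real_bits_def inv rat_bits_def q)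
qed

text \<open>The ceiling \<open>M\<close> covers the memory and all intermediate results, so each
  operation has the same price. The factor \<open>2 * M + 5\<close> is the price of a value; natural
  numbers are cheaper, but one factor then serves all kinds of expressions.\<close>

lemma ncost_bound:
  assumes "state_bound D B s" "nexp_bound B e" "B + ncost (\<lambda>_. 1) s e \<le> M"
  shows "ncost nat_bits s e \<le> ncost (\<lambda>_. 1) s e * (2 * M + 5)"
  using assms(2,3)
proof (induction e)
  case (NConst k)
  then have "k < 2 ^ B" "B \<le> M" by simp_all
  then have "nat_bits k \<le> 1 + M" by (intro nat_bits_le) (rule less_power2_mono)
  then show ?case by simp
next
  case (NRead x e)
  have "nat_bits (nval s (NRead x e)) \<le> 1 + M"
    using nval_bound[OF assms(1) NRead.prems(1)] NRead.prems(2) by (intro nat_bits_le) (rule less_power2_mono)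
  then show ?case using NRead by (auto simp: algebra_simps)
next
  case (NPlus e f)
  have "nat_bits (nval s (NPlus e f)) \<le> 1 + M"
    using nval_bound[OF assms(1) NPlus.prems(1)] NPlus.prems(2) by (intro nat_bits_le) (rule less_power2_mono)
  moreover have "ncost nat_bits s e \<le> ncost (\<lambda>_. 1) s e * (2 * M + 5)" "ncost nat_bits s f \<le> ncost (\<lambda>_. 1) s f * (2 * M + 5)"
    using NPlus by auto
  ultimately show ?case by (simp add: algebra_simps)
next
  case (NMinus e f)
  have "nat_bits (nval s (NMinus e f)) \<le> 1 + M"
    using nval_bound[OF assms(1) NMinus.prems(1)] NMinus.prems(2) by (intro nat_bits_le) (rule less_power2_mono)
  moreover have "ncost nat_bits s e \<le> ncost (\<lambda>_. 1) s e * (2 * M + 5)" "ncost nat_bits s f \<le> ncost (\<lambda>_. 1) s f * (2 * M + 5)"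
    using NMinus by auto
  ultimately show ?case by (simp add: algebra_simps)
qed

lemma vcost_bound:
  assumes "state_bound D B s" "vexp_bound B e" "B + vcost (\<lambda>_. 1) (\<lambda>_. 1) s e \<le> M"
    and D: "0 < D" "D < 2 ^ Suc M"
  shows "vcost nat_bits real_bits s e \<le> vcost (\<lambda>_. 1) (\<lambda>_. 1) s e * (2 * M + 5)"
  using assms(2,3)
proof (induction e)
  case VZero
  have "real_bits 0 \<le> 2 * M + 5"
    by (rule real_bits_le[OF _ D(2,1)]) (auto simp: represented_def intro!: exI[of _ 0])
  then show ?case by simp
next
  case (VRead x e)
  have "real_bits (vval s (VRead x e)) \<le> 2 * M + 5"
    using VRead.prems by (intro real_bits_le[OF _ D(2,1)] represented_mono[OF vval_bound[OF assms(1)]])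
  moreover have "ncost nat_bits s e \<le> ncost (\<lambda>_. 1) s e * (2 * M + 5)"
    using VRead by (intro ncost_bound[OF assms(1)]) auto
  ultimately show ?case by (simp add: algebra_simps)
next
  case (VPlus e f)
  have "real_bits (vval s (VPlus e f)) \<le> 2 * M + 5"
    using VPlus.prems by (intro real_bits_le[OF _ D(2,1)] represented_mono[OF vval_bound[OF assms(1)]])
  moreover have "vcost nat_bits real_bits s e \<le> vcost (\<lambda>_. 1) (\<lambda>_. 1) s e * (2 * M + 5)"
      "vcost nat_bits real_bits s f \<le> vcost (\<lambda>_. 1) (\<lambda>_. 1) s f * (2 * M + 5)"
    using VPlus by auto
  ultimately show ?case by (simp add: algebra_simps)
next
  case (VMinus e f)
  have "real_bits (vval s (VMinus e f)) \<le> 2 * M + 5"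
    using VMinus.prems by (intro real_bits_le[OF _ D(2,1)] represented_mono[OF vval_bound[OF assms(1)]])
  moreover have "vcost nat_bits real_bits s e \<le> vcost (\<lambda>_. 1) (\<lambda>_. 1) s e * (2 * M + 5)"
      "vcost nat_bits real_bits s f \<le> vcost (\<lambda>_. 1) (\<lambda>_. 1) s f * (2 * M + 5)"
    using VMinus by auto
  ultimately show ?case by (simp add: algebra_simps)
qed

lemma bcost_bound:
  assumes "state_bound D B s" "bexp_bound B e" "B + bcost (\<lambda>_. 1) (\<lambda>_. 1) s e \<le> M"
    and D: "0 < D" "D < 2 ^ Suc M"
  shows "bcost nat_bits real_bits s e \<le> bcost (\<lambda>_. 1) (\<lambda>_. 1) s e * (2 * M + 5)"
  using assms(2,3)
proof (induction e)
  case (NLess e f)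
  have "ncost nat_bits s e \<le> ncost (\<lambda>_. 1) s e * (2 * M + 5)" "ncost nat_bits s f \<le> ncost (\<lambda>_. 1) s f * (2 * M + 5)"
    using NLess by (intro ncost_bound[OF assms(1)]; simp)+
  then show ?case by (simp add: algebra_simps)
next
  case (VLess e f)
  have "vcost nat_bits real_bits s e \<le> vcost (\<lambda>_. 1) (\<lambda>_. 1) s e * (2 * M + 5)"
      "vcost nat_bits real_bits s f \<le> vcost (\<lambda>_. 1) (\<lambda>_. 1) s f * (2 * M + 5)"
    using VLess by (intro vcost_bound[OF assms(1) _ _ D]; simp)+
  then show ?case by (simp add: algebra_simps)
qed (auto simp: algebra_simps)

text \<open>Charges do not influence control flow, so the run is the same under both measures. The
  bound \<open>B\<close> grows with elapsed time and is therefore generalised, while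
  \<open>M\<close> stays fixed; each unit step is then charged at most \<open>2 * M + 5\<close>, and
  the charges of successive parts add up.\<close>

lemma bit_exec_of_unit_exec:
  assumes "exec (\<lambda>_. 1) (\<lambda>_. 1) c s t s'" "state_bound D B s" "com_bound B c" "B + t \<le> M"
    and D: "0 < D" "D < 2 ^ Suc M"
  shows "state_bound D (B + t) s' \<and> (\<exists>t'\<le>t * (2 * M + 5). exec nat_bits real_bits c s t' s')"
  using assms(1-4)
proof (induction arbitrary: B rule: exec.induct)
  case (exec_Skip s)
  then show ?case
    by (intro conjI exI[of _ 1] state_bound_mono[OF exec_Skip(1)] exec.exec_Skip) auto
next
  case (exec_NAssign x e f s)
  let ?t = "1 + ncost (\<lambda>_. 1) s e + ncost (\<lambda>_. 1) s f"
  have "nval s f < 2 ^ (B + ?t)"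
    by (rule less_power2_mono[OF nval_bound[OF exec_NAssign(1)]]) (use exec_NAssign in auto)
  moreover have "state_bound D (B + ?t) s" by (rule state_bound_mono[OF exec_NAssign(1)]) simp
  ultimately have "state_bound D (B + ?t) (nupdate x (nval s e) (nval s f) s)"
    by (auto simp: state_bound_def nupdate_def)
  moreover have "ncost nat_bits s e \<le> ncost (\<lambda>_. 1) s e * (2 * M + 5)"
      "ncost nat_bits s f \<le> ncost (\<lambda>_. 1) s f * (2 * M + 5)"
    by (intro ncost_bound[OF exec_NAssign(1)]; use exec_NAssign in simp)+
  ultimately show ?case
    by (intro conjI exI[of _ "1 + ncost nat_bits s e + ncost nat_bits s f"] exec.exec_NAssign) (auto simp: algebra_simps)
next
  case (exec_VAssign x e f s)
  let ?t = "1 + ncost (\<lambda>_. 1) s e + vcost (\<lambda>_. 1) (\<lambda>_. 1) s f"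
  have "represented D (B + ?t) (vval s f)"
    by (rule represented_mono[OF vval_bound[OF exec_VAssign(1)]]) (use exec_VAssign in auto)
  moreover have "state_bound D (B + ?t) s" by (rule state_bound_mono[OF exec_VAssign(1)]) simp
  ultimately have "state_bound D (B + ?t) (vupdate x (nval s e) (vval s f) s)"
    by (auto simp: state_bound_def vupdate_def)
  moreover have "ncost nat_bits s e \<le> ncost (\<lambda>_. 1) s e * (2 * M + 5)"
    by (intro ncost_bound[OF exec_VAssign(1)]; use exec_VAssign in simp)+
  moreover have "vcost nat_bits real_bits s f \<le> vcost (\<lambda>_. 1) (\<lambda>_. 1) s f * (2 * M + 5)"
    by (intro vcost_bound[OF exec_VAssign(1) _ _ D]; use exec_VAssign in simp)
  ultimately show ?case
    by (intro conjI exI[of _ "1 + ncost nat_bits s e + vcost nat_bits real_bits s f"] exec.exec_VAssign) (auto simp: algebra_simps)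
next
  case (exec_Seq c s t s' d t' s'')
  then obtain a where a: "state_bound D (B + t) s'" "a \<le> t * (2 * M + 5)" "exec nat_bits real_bits c s a s'"
    by (auto dest!: exec_Seq.IH(1))
  have "state_bound D (B + t + t') s'' \<and> (\<exists>b\<le>t' * (2 * M + 5). exec nat_bits real_bits d s' b s'')"
    by (rule exec_Seq.IH(2)[OF a(1)]) (use exec_Seq.prems com_bound_mono[of B d "B + t"] in auto)
  then obtain b where b: "state_bound D (B + t + t') s''" "b \<le> t' * (2 * M + 5)" "exec nat_bits real_bits d s' b s''"
    by auto
  then show ?case using a
    by (intro conjI exI[of _ "a + b"] exec.exec_Seq) (auto simp: algebra_simps)
next
  case (exec_CondTrue s b c t s' d)
  let ?k = "bcost (\<lambda>_. 1) (\<lambda>_. 1) s b"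
  have k: "bcost nat_bits real_bits s b \<le> ?k * (2 * M + 5)"
    by (rule bcost_bound[OF exec_CondTrue.prems(1) _ _ D]) (use exec_CondTrue.prems in auto)
  obtain a where a: "state_bound D (B + t) s'" "a \<le> t * (2 * M + 5)" "exec nat_bits real_bits c s a s'"
    using exec_CondTrue.IH[OF exec_CondTrue.prems(1)] exec_CondTrue.prems by auto
  have "state_bound D (B + (1 + ?k + t)) s'" by (rule state_bound_mono[OF a(1)]) simp
  then show ?case using a k exec_CondTrue.hyps
    by (intro conjI exI[of _ "1 + bcost nat_bits real_bits s b + a"] exec.exec_CondTrue)
      (auto simp: algebra_simps)
next
  case (exec_CondFalse s b d t s' c)
  let ?k = "bcost (\<lambda>_. 1) (\<lambda>_. 1) s b"
  have k: "bcost nat_bits real_bits s b \<le> ?k * (2 * M + 5)"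
    by (rule bcost_bound[OF exec_CondFalse.prems(1) _ _ D]) (use exec_CondFalse.prems in auto)
  obtain a where a: "state_bound D (B + t) s'" "a \<le> t * (2 * M + 5)" "exec nat_bits real_bits d s a s'"
    using exec_CondFalse.IH[OF exec_CondFalse.prems(1)] exec_CondFalse.prems by auto
  have "state_bound D (B + (1 + ?k + t)) s'" by (rule state_bound_mono[OF a(1)]) simp
  then show ?case using a k exec_CondFalse.hyps
    by (intro conjI exI[of _ "1 + bcost nat_bits real_bits s b + a"] exec.exec_CondFalse)
      (auto simp: algebra_simps)
next
  case (exec_WhileFalse s b c)
  let ?k = "bcost (\<lambda>_. 1) (\<lambda>_. 1) s b"
  have k: "bcost nat_bits real_bits s b \<le> ?k * (2 * M + 5)"
    by (rule bcost_bound[OF exec_WhileFalse.prems(1) _ _ D]) (use exec_WhileFalse.prems in auto)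
  moreover have "state_bound D (B + (1 + ?k)) s" by (rule state_bound_mono[OF exec_WhileFalse.prems(1)]) simp
  ultimately show ?case using exec_WhileFalse.hyps
    by (intro conjI exI[of _ "1 + bcost nat_bits real_bits s b"] exec.exec_WhileFalse)
      (auto simp: algebra_simps)
next
  case (exec_WhileTrue s b c t s' t' s'')
  let ?k = "bcost (\<lambda>_. 1) (\<lambda>_. 1) s b"
  have k: "bcost nat_bits real_bits s b \<le> ?k * (2 * M + 5)"
    by (rule bcost_bound[OF exec_WhileTrue.prems(1) _ _ D]) (use exec_WhileTrue.prems in auto)
  obtain a1 where a: "state_bound D (B + t) s'" "a1 \<le> t * (2 * M + 5)" "exec nat_bits real_bits c s a1 s'"
    using exec_WhileTrue.IH(1)[OF exec_WhileTrue.prems(1)] exec_WhileTrue.prems by auto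
  have "state_bound D (B + t + t') s'' \<and> (\<exists>b'\<le>t' * (2 * M + 5). exec nat_bits real_bits (While b c) s' b' s'')"
    by (rule exec_WhileTrue.IH(2)[OF a(1)]) (use exec_WhileTrue.prems com_bound_mono[of B "While b c" "B + t"] in auto)
  then obtain a2 where a2: "state_bound D (B + t + t') s''" "a2 \<le> t' * (2 * M + 5)"
      "exec nat_bits real_bits (While b c) s' a2 s''" by auto
  have "state_bound D (B + (1 + ?k + t + t')) s''" by (rule state_bound_mono[OF a2(1)]) simp
  then show ?case using a a2 k exec_WhileTrue.hyps
    by (intro conjI exI[of _ "1 + bcost nat_bits real_bits s b + a1 + a2"] exec.exec_WhileTrue)
      (auto simp: algebra_simps)
qed

section \<open>Potentials and augmenting paths\<close>

locale weights =
  fixes n m :: nat and g :: "nat \<Rightarrow> nat \<Rightarrow> real"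
begin

definition feasible :: "(nat \<Rightarrow> real) \<Rightarrow> (nat \<Rightarrow> real) \<Rightarrow> bool" where
  "feasible u w \<longleftrightarrow> (\<forall>i<n. 0 \<le> w i \<and> (\<forall>h<m. g i h \<le> u h + w i))"

abbreviation tight :: "(nat \<Rightarrow> real) \<Rightarrow> (nat \<Rightarrow> real) \<Rightarrow> nat \<Rightarrow> nat \<Rightarrow> bool" where
  "tight u w i h \<equiv> g i h = u h + w i"

text \<open>As in the output array, \<open>p i = h + 1\<close> says that agent \<open>i\<close> has house \<open>h\<close>, and \<open>p i = 0\<close> that it has none.\<close>

definition matching :: "nat \<Rightarrow> (nat \<Rightarrow> nat) \<Rightarrow> (nat \<Rightarrow> real) \<Rightarrow> (nat \<Rightarrow> real) \<Rightarrow> bool" where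
  "matching k p u w \<longleftrightarrow> feasible u w \<and>
     (\<forall>i<n. p i = 0 \<longrightarrow> w i = 0) \<and>
     (\<forall>i<n. p i \<noteq> 0 \<longrightarrow> tight u w i (p i - 1)) \<and>
     (\<forall>i<n. p i \<le> k) \<and>
     (\<forall>i<n. \<forall>j<n. p i \<noteq> 0 \<longrightarrow> p i = p j \<longrightarrow> i = j) \<and>
     (\<forall>h<k. \<exists>i<n. p i = Suc h)"

text \<open>
  The agent \<open>n\<close> is fictitious: it holds the house \<open>k\<close> to be inserted and is the root of the tree.  The
  rank \<open>r j\<close> is \<open>0\<close> for agents outside the tree and increases in order of discovery otherwise; agent
  \<open>y j\<close> is the parent of \<open>j\<close>, whose house \<open>j\<close> takes over in an augmentation.
\<close>

definition search_tree :: "nat \<Rightarrow> nat \<Rightarrow> (nat \<Rightarrow> nat) \<Rightarrow> (nat \<Rightarrow> real) \<Rightarrow> (nat \<Rightarrow> real) \<Rightarrow>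
    (nat \<Rightarrow> nat) \<Rightarrow> (nat \<Rightarrow> nat) \<Rightarrow> bool" where
  "search_tree k l p u w r y \<longleftrightarrow> matching k p u w \<and> p n = Suc k \<and> r n = 1 \<and>
     (\<forall>j\<le>n. r j \<le> Suc l) \<and>
     (\<forall>j<n. r j \<noteq> 0 \<longrightarrow> 2 \<le> r j \<and> y j \<le> n \<and> r (y j) \<noteq> 0 \<and> r (y j) < r j \<and>
        p (y j) \<noteq> 0 \<and> tight u w j (p (y j) - 1))"

text \<open>This describes a search that has not yet reached an agent without a house. Each round
  adds one agent; the count includes the root \<open>n\<close>.\<close>

definition growing :: "nat \<Rightarrow> (nat \<Rightarrow> nat) \<Rightarrow> (nat \<Rightarrow> nat) \<Rightarrow> bool" where
  "growing l p r \<longleftrightarrow> (\<forall>j\<le>n. r j \<noteq> 0 \<longrightarrow> p j \<noteq> 0) \<and> card {j. j \<le> n \<and> r j \<noteq> 0} = Suc l"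

lemma matchingD:
  assumes "matching k p u w" "i < n"
  shows "h < m \<Longrightarrow> g i h \<le> u h + w i" "0 \<le> w i" "p i = 0 \<Longrightarrow> w i = 0"
    "p i \<noteq> 0 \<Longrightarrow> tight u w i (p i - 1)" "p i \<le> k"
  using assms by (simp_all add: matching_def feasible_def)

text \<open>The cell of the fictitious agent is outside the range of all conditions on a matching,
  so the root may be given the new house at no risk.\<close>

lemma matching_fun_upd:
  assumes "matching k p u w"
  shows "matching k (p(n := x)) u w"
proof -
  have "\<exists>i<n. (p(n := x)) i = Suc h" if h: "h < k" for h
  proof -
    obtain i where "i < n" "p i = Suc h" using assms h by (auto simp: matching_def)
    then show ?thesis by (intro exI[of _ i]) simp
  qed
  then show ?thesis using assms unfolding matching_def by simp
qed

lemma search_treeD: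
  assumes "search_tree k l p u w r y"
  shows "matching k p u w" "p n = Suc k" "r n = 1" "j \<le> n \<Longrightarrow> r j \<le> Suc l"
  using assms by (simp_all add: search_tree_def)

lemma search_tree_wayD:
  assumes "search_tree k l p u w r y" "j < n" "r j \<noteq> 0"
  shows "2 \<le> r j" "y j \<le> n" "r (y j) \<noteq> 0" "r (y j) < r j" "p (y j) \<noteq> 0" "tight u w j (p (y j) - 1)"
  using assms by (simp_all add: search_tree_def)

lemma search_tree_le:
  assumes "search_tree k l p u w r y" "j \<le> n"
  shows "p j \<le> Suc k"
  using matchingD(5)[OF search_treeD(1)[OF assms(1)], of j] search_treeD(2)[OF assms(1)] assms(2)
  by (cases "j = n") auto

text \<open>The entries of real agents are at most \<open>k\<close> and that of the root is
  \<open>Suc k\<close>, so injectivity of the matching extends to the root.\<close>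

lemma search_tree_inj:
  assumes "search_tree k l p u w r y" "i \<le> n" "j \<le> n" "p i \<noteq> 0" "p i = p j"
  shows "i = j"
proof -
  have p: "i < n \<Longrightarrow> p i \<le> k" "j < n \<Longrightarrow> p j \<le> k" "p n = Suc k"
    using assms by (auto simp: search_tree_def matching_def)
  show ?thesis
  proof (cases "i = n \<or> j = n")
    case True
    then show ?thesis using p assms(2,3,5) by (metis Suc_n_not_le_n le_neq_implies_less)
  next
    case False
    then show ?thesis using assms by (auto simp: search_tree_def matching_def)
  qed
qed

lemma search_tree_start:
  assumes "matching k p u w" "p n = Suc k" "\<forall>j<n. r j = 0" "r n = 1"
  shows "search_tree k 0 p u w r y" "growing 0 p r"
proof -
  have "{j. j \<le> n \<and> r j \<noteq> 0} = {n}" using assms(3,4) by (auto simp: le_less)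
  moreover have "\<forall>j\<le>n. r j \<noteq> 0 \<longrightarrow> p j \<noteq> 0" using assms(2,3) by (auto simp: le_less)
  ultimately show "growing 0 p r" by (simp add: growing_def One_nat_def)
  show "search_tree k 0 p u w r y" using assms by (auto simp: search_tree_def le_less)
qed

lemma growing_unused:
  assumes "growing l p r" "l < n" "r n = 1"
  shows "\<exists>j<n. r j = 0"
proof (rule ccontr)
  assume "\<not> ?thesis"
  then have "{j. j \<le> n \<and> r j \<noteq> 0} = {..n}" using assms(3) by (auto simp: le_less)
  then show False using assms by (simp add: growing_def)
qed

text \<open>Pigeonhole: after \<open>n\<close> rounds without success all \<open>Suc n\<close>
  agents, including the root, would hold different houses among the first
  \<open>Suc k \<le> n\<close>.\<close>

lemma not_growing_full:
  assumes "search_tree k n p u w r y" "growing n p r" "k < n"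
  shows False
proof -
  have "{j. j \<le> n \<and> r j \<noteq> 0} = {..n}"
    by (rule card_subset_eq) (use assms in \<open>auto simp: growing_def\<close>)
  then have nz: "p j \<noteq> 0" if "j \<le> n" for j using assms(2) that unfolding growing_def by blast
  have "inj_on p {..n}" using search_tree_inj[OF assms(1)] nz by (auto simp: inj_on_def)
  moreover have "p ` {..n} \<subseteq> {1..Suc k}"
  proof
    fix x assume "x \<in> p ` {..n}"
    then obtain j where j: "j \<le> n" "x = p j" by auto
    have "p j \<le> Suc k" using assms(1) j unfolding search_tree_def matching_def
      by (metis le_SucI le_less order_refl)
    then show "x \<in> {1..Suc k}" using nz[OF j(1)] j by auto
  qed
  ultimately have "card {..n} \<le> card {1..Suc k}" by (metis card_inj_on_le finite_atLeastAtMost)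
  then show False using assms(3) by simp
qed

text \<open>The houses held in the tree lose \<open>d\<close>, the agents of the tree gain
  \<open>d\<close>. On edges inside the tree both changes cancel, so tree edges and matched edges
  stay tight. An edge from a tree house to an agent outside loses slack \<open>d\<close>, which
  minimality permits; one from another house to a tree agent gains slack. An agent without a house
  is outside the tree, so its \<open>w\<close> remains zero.\<close>

lemma search_tree_grow:
  assumes tree: "search_tree k l p u w r y" and grow: "growing l p r"
    and b: "b < n" "r b = 0" and c: "c \<le> n" "r c \<noteq> 0"
    and d: "d = u (p c - 1) + w b - g b (p c - 1)"
    and min: "\<And>i j. i \<le> n \<Longrightarrow> r i \<noteq> 0 \<Longrightarrow> j < n \<Longrightarrow> r j = 0 \<Longrightarrow> d \<le> u (p i - 1) + w j - g j (p i - 1)"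
    and k: "k < m"
    and u': "\<And>h. h < m \<Longrightarrow> u' h = u h - (if \<exists>j\<le>n. r j \<noteq> 0 \<and> p j = Suc h then d else 0)"
    and w': "\<And>j. j < n \<Longrightarrow> w' j = w j + (if r j \<noteq> 0 then d else 0)"
  shows "search_tree k (Suc l) p u' w' (r(b := l + 2)) (y(b := c))"
    and "p b \<noteq> 0 \<Longrightarrow> growing (Suc l) p (r(b := l + 2))"
proof -
  note T = search_treeD[OF tree]
  note M = matchingD[OF T(1)]
  note Y = search_tree_wayD[OF tree]
  note p_le = search_tree_le[OF tree]
  have pm: "p j - 1 < m" if "j \<le> n" for j using p_le[OF that] k by simp
  have pn0: "p j \<noteq> 0" if "j \<le> n" "r j \<noteq> 0" for j using grow that by (auto simp: growing_def)
  \<comment> \<open>\<open>d\<close> is itself the slack of a feasible edge.\<close>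
  have d0: "0 \<le> d" using M(1)[OF b(1) pm[OF c(1)]] d by simp
  have row: "u' (p j - 1) = u (p j - 1) - d" if "j \<le> n" "r j \<noteq> 0" for j
    using u'[OF pm[OF that(1)]] that pn0[OF that] by force
  have row': "u' (p j - 1) = u (p j - 1)" if j: "j \<le> n" "r j = 0" "p j \<noteq> 0" for j
  proof -
    have "\<not> (\<exists>i\<le>n. r i \<noteq> 0 \<and> p i = Suc (p j - 1))"
    proof
      assume "\<exists>i\<le>n. r i \<noteq> 0 \<and> p i = Suc (p j - 1)"
      then obtain i where i: "i \<le> n" "r i \<noteq> 0" "p i = p j" using j(3) by auto
      then have "j = i" using search_tree_inj[OF tree j(1) i(1) j(3)] by simp
      then show False using i j by simp
    qed
    then show ?thesis using u'[OF pm[OF j(1)]] by (simp only: if_False diff_0_right)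
  qed
  have feas: "feasible u' w'"
    unfolding feasible_def
  proof (intro allI impI conjI)
    fix i assume i: "i < n"
    show "0 \<le> w' i" using w'[OF i] M(2)[OF i] d0 by auto
    fix h assume h: "h < m"
    note old = M(1)[OF i h]
    show "g i h \<le> u' h + w' i"
    proof (cases "\<exists>j\<le>n. r j \<noteq> 0 \<and> p j = Suc h")
      case True
      then obtain j where j: "j \<le> n" "r j \<noteq> 0" "p j = Suc h" by blast
      show ?thesis using min[OF j(1,2) i] j u'[OF h] w'[OF i] old True by (cases "r i = 0") auto
    next
      case False
      then show ?thesis using u'[OF h] w'[OF i] old d0 by (auto split: if_splits)
    qed
  qed
  have match: "matching k p u' w'"
    unfolding matching_def
  proof (intro conjI feas)
    show "\<forall>i<n. p i = 0 \<longrightarrow> w' i = 0"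
    proof (intro allI impI)
      fix i assume i: "i < n" "p i = 0"
      then have "r i = 0" using pn0[of i] by auto
      then show "w' i = 0" using w'[OF i(1)] M(3)[OF i] by simp
    qed
    show "\<forall>i<n. p i \<noteq> 0 \<longrightarrow> tight u' w' i (p i - 1)"
    proof (intro allI impI)
      fix i assume i: "i < n" "p i \<noteq> 0"
      then have "tight u w i (p i - 1)" by (rule M(4))
      then show "tight u' w' i (p i - 1)"
        using row[of i] row'[of i] w'[OF i(1)] i by (cases "r i = 0") auto
    qed
  qed (use T(1) in \<open>simp_all add: matching_def\<close>)
  show "search_tree k (Suc l) p u' w' (r(b := l + 2)) (y(b := c))"
    unfolding search_tree_def
  proof (intro conjI match)
    show "p n = Suc k" "(r(b := l + 2)) n = 1" using T(2,3) b by auto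
    show "\<forall>j\<le>n. (r(b := l + 2)) j \<le> Suc (Suc l)" using T(4) by (auto simp: le_SucI)
    \<comment> \<open>Earlier ranks are at most \<open>Suc l\<close>, so the new rank
      \<open>l + 2\<close> exceeds that of the parent \<open>c\<close>.\<close>
    have rc: "r c \<le> Suc l" using T(4) c by blast
    have cb: "c \<noteq> b" using b c by auto
    show "\<forall>j<n. (r(b := l + 2)) j \<noteq> 0 \<longrightarrow> 2 \<le> (r(b := l + 2)) j \<and> (y(b := c)) j \<le> n \<and>
        (r(b := l + 2)) ((y(b := c)) j) \<noteq> 0 \<and> (r(b := l + 2)) ((y(b := c)) j) < (r(b := l + 2)) j \<and>
        p ((y(b := c)) j) \<noteq> 0 \<and> tight u' w' j (p ((y(b := c)) j) - 1)"
    proof (intro allI impI)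
      fix j assume j: "j < n" "(r(b := l + 2)) j \<noteq> 0"
      show "2 \<le> (r(b := l + 2)) j \<and> (y(b := c)) j \<le> n \<and>
        (r(b := l + 2)) ((y(b := c)) j) \<noteq> 0 \<and> (r(b := l + 2)) ((y(b := c)) j) < (r(b := l + 2)) j \<and>
        p ((y(b := c)) j) \<noteq> 0 \<and> tight u' w' j (p ((y(b := c)) j) - 1)"
      proof (cases "j = b")
        case True
        \<comment> \<open>\<open>d\<close> is the slack of this very edge: its house is lowered by
          \<open>d\<close>, while \<open>b\<close> was outside the tree and keeps its potential, so
          the edge becomes tight.\<close>
        then show ?thesis using c rc cb pn0[OF c] row[OF c] w'[OF b(1)] b d by auto
      next
        case False
        then have rj: "r j \<noteq> 0" using j by simp
        then have tj: "2 \<le> r j \<and> y j \<le> n \<and> r (y j) \<noteq> 0 \<and> r (y j) < r j \<and>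
            p (y j) \<noteq> 0 \<and> tight u w j (p (y j) - 1)" using Y[OF j(1)] by blast
        moreover have "y j \<noteq> b" using tj b by auto
        moreover have "tight u' w' j (p (y j) - 1)" using tj row[of "y j"] w'[OF j(1)] rj by auto
        ultimately show ?thesis using False by auto
      qed
    qed
  qed
  show "growing (Suc l) p (r(b := l + 2))" if "p b \<noteq> 0"
  proof -
    have "{j. j \<le> n \<and> (r(b := l + 2)) j \<noteq> 0} = insert b {j. j \<le> n \<and> r j \<noteq> 0}" using b by auto
    then show ?thesis using grow that b by (auto simp: growing_def)
  qed
qed

text \<open>
  Augmentation moves a vacancy \<open>c\<close> towards the root.  Ranks decrease on the way, so the parent of the
  vacancy still has its original house, and at most \<open>n\<close> moves are needed.
\<close>

definition augmenting :: "nat \<Rightarrow> nat \<Rightarrow> (nat \<Rightarrow> nat) \<Rightarrow> (nat \<Rightarrow> nat) \<Rightarrow> nat \<Rightarrow> (nat \<Rightarrow> real) \<Rightarrow>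
    (nat \<Rightarrow> real) \<Rightarrow> (nat \<Rightarrow> nat) \<Rightarrow> bool" where
  "augmenting k t p p0 c u w r \<longleftrightarrow> c \<le> n \<and> r c \<noteq> 0 \<and> (c = n \<or> r c + t \<le> Suc n) \<and>
     (\<forall>j\<le>n. r j < r c \<longrightarrow> p j = p0 j) \<and>
     (\<forall>i\<le>n. \<forall>j\<le>n. i \<noteq> c \<longrightarrow> j \<noteq> c \<longrightarrow> p i \<noteq> 0 \<longrightarrow> p i = p j \<longrightarrow> i = j) \<and>
     (\<forall>h\<le>k. \<exists>j\<le>n. j \<noteq> c \<and> p j = Suc h) \<and>
     (\<forall>j\<le>n. p j \<le> Suc k) \<and>
     (\<forall>j<n. j \<noteq> c \<longrightarrow> p j \<noteq> 0 \<longrightarrow> tight u w j (p j - 1)) \<and>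
     (\<forall>j<n. p j = 0 \<longrightarrow> w j = 0)"

text \<open>Ranks are at most \<open>Suc n\<close>, which is the full budget of moves.\<close>

lemma augmenting_start:
  assumes tree: "search_tree k n p u w r y" and c: "c < n" "r c \<noteq> 0" "p c = 0"
  shows "augmenting k 0 p p c u w r"
proof -
  note T = search_treeD[OF tree]
  have "\<exists>j\<le>n. j \<noteq> c \<and> p j = Suc h" if "h \<le> k" for h
  proof (cases "h = k")
    case True
    then show ?thesis using T(2) c by auto
  next
    case False
    then obtain i where "i < n" "p i = Suc h" using T(1) \<open>h \<le> k\<close> unfolding matching_def by (meson le_neq_implies_less)
    then show ?thesis using c by (intro exI[of _ i]) auto
  qed
  then show ?thesis
    unfolding augmenting_def
    using c T(4)[of c] matchingD(3,4)[OF T(1)] search_tree_le[OF tree] search_tree_inj[OF tree] by auto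
qed

text \<open>The vacancy \<open>c\<close> takes over the house of its parent along a tight edge and
  the parent becomes vacant. The decrease of rank is used twice: it shows that the parent's entry
  has not been overwritten, and it pays for the increase of \<open>t\<close>.\<close>

lemma augmenting_step:
  assumes tree: "search_tree k n p0 u w r y" and aug: "augmenting k t p p0 c u w r" and c: "c \<noteq> n"
  shows "augmenting k (Suc t) (p(c := p (y c))) p0 (y c) u w r"
proof -
  note A = aug[unfolded augmenting_def]
  have cn: "c < n" "r c \<noteq> 0" using A c by auto
  define d where "d = y c"
  have d: "d \<le> n" "r d \<noteq> 0" "r d < r c" "p0 d \<noteq> 0" "tight u w c (p0 d - 1)"
    using search_tree_wayD[OF tree cn] unfolding d_def by auto
  have pd: "p d = p0 d" using A d by auto
  have dc: "d \<noteq> c" using d by auto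
  have "(\<forall>j\<le>n. r j < r d \<longrightarrow> (p(c := p d)) j = p0 j)" using A d by auto
  moreover have "\<forall>i\<le>n. \<forall>j\<le>n. i \<noteq> d \<longrightarrow> j \<noteq> d \<longrightarrow> (p(c := p d)) i \<noteq> 0 \<longrightarrow>
      (p(c := p d)) i = (p(c := p d)) j \<longrightarrow> i = j"
  proof (intro allI impI)
    fix i j assume ij: "i \<le> n" "j \<le> n" "i \<noteq> d" "j \<noteq> d" "(p(c := p d)) i \<noteq> 0" "(p(c := p d)) i = (p(c := p d)) j"
    have inj: "\<And>i j. i \<le> n \<Longrightarrow> j \<le> n \<Longrightarrow> i \<noteq> c \<Longrightarrow> j \<noteq> c \<Longrightarrow> p i \<noteq> 0 \<Longrightarrow> p i = p j \<Longrightarrow> i = j" using A by blast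
    show "i = j"
    proof (cases "i = c \<or> j = c")
      case True
      then show ?thesis using ij(3-6) inj[OF d(1) ij(1) dc] inj[OF d(1) ij(2) dc] by (auto split: if_splits)
    next
      case False
      then show ?thesis using ij(5,6) inj[OF ij(1,2)] by auto
    qed
  qed
  moreover have "\<forall>h\<le>k. \<exists>j\<le>n. j \<noteq> d \<and> (p(c := p d)) j = Suc h"
  proof (intro allI impI)
    fix h assume "h \<le> k"
    then obtain j where j: "j \<le> n" "j \<noteq> c" "p j = Suc h" using A by blast
    \<comment> \<open>Only the house of the parent \<open>d\<close> changes hands; its new holder is
      \<open>c\<close>.\<close>
    show "\<exists>j\<le>n. j \<noteq> d \<and> (p(c := p d)) j = Suc h"
      by (rule exI[of _ "if j = d then c else j"]) (use j dc cn in auto)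
  qed
  moreover have "d = n \<or> r d + Suc t \<le> Suc n" using A c d by auto
  moreover have "\<forall>j\<le>n. (p(c := p d)) j \<le> Suc k" using A d(1) by simp
  moreover have "\<forall>j<n. j \<noteq> d \<longrightarrow> (p(c := p d)) j \<noteq> 0 \<longrightarrow> tight u w j ((p(c := p d)) j - 1)"
    using A d(5) pd by simp
  moreover have "\<forall>j<n. (p(c := p d)) j = 0 \<longrightarrow> w j = 0" using A d(4) pd by simp
  ultimately show ?thesis
    unfolding augmenting_def d_def[symmetric] using d(1,2) by blast
qed

text \<open>Ranks below the root are at least 2, so after \<open>n\<close> moves the budget
  \<open>r c + n \<le> Suc n\<close> is exhausted and the vacancy must be the root. Thus the
  fictitious agent gives up its house, and real agents hold all \<open>Suc k\<close> houses.\<close>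

lemma augmenting_finish:
  assumes tree: "search_tree k n p0 u w r y" and aug: "augmenting k n p p0 c u w r"
  shows "c = n" "matching (Suc k) p u w"
proof -
  note T = search_treeD[OF tree]
  note A = aug[unfolded augmenting_def]
  show c: "c = n"
  proof (rule ccontr)
    assume "c \<noteq> n"
    then have "c < n" "r c \<noteq> 0" "r c + n \<le> Suc n" using A by auto
    moreover have "2 \<le> r c" using search_tree_wayD(1)[OF tree \<open>c < n\<close> \<open>r c \<noteq> 0\<close>] .
    ultimately show False by simp
  qed
  have "\<exists>i<n. p i = Suc h" if "h < Suc k" for h
  proof -
    have "\<exists>j\<le>n. j \<noteq> n \<and> p j = Suc h" using A c that by (simp add: less_Suc_eq_le)
    then show ?thesis by (auto simp: le_less)
  qed
  moreover have "feasible u w" using T(1) by (simp add: matching_def)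
  ultimately show "matching (Suc k) p u w"
    unfolding matching_def using A c by simp
qed

end

section \<open>Total envy, matching weight and duality\<close>

lemma sum_assigned_houses:
  fixes f :: "nat \<Rightarrow> real" and n m :: nat
  assumes "is_allocation {..<n} {..<m} A" "\<forall>h<m. \<exists>i<n. A i = Some h"
  shows "(\<Sum>i<n. case A i of None \<Rightarrow> 0 | Some h \<Rightarrow> f h) = (\<Sum>h<m. f h)"
proof -
  let ?S = "{i. i < n \<and> A i \<noteq> None}"
  have "(\<Sum>i<n. case A i of None \<Rightarrow> 0 | Some h \<Rightarrow> f h) = (\<Sum>i\<in>?S. f (the (A i)))"
    by (intro sum.mono_neutral_cong_right) auto
  also have "\<dots> = (\<Sum>h<m. f h)"
  proof (rule sum.reindex_bij_betw)
    have "inj_on (\<lambda>i. the (A i)) ?S" using assms(1) unfolding is_allocation_def inj_on_def by fastforce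
    moreover have "(\<lambda>i. the (A i)) ` ?S = {..<m}"
    proof
      show "(\<lambda>i. the (A i)) ` ?S \<subseteq> {..<m}" using assms(1) by (auto simp: is_allocation_def)
      show "{..<m} \<subseteq> (\<lambda>i. the (A i)) ` ?S"
      proof
        fix h assume "h \<in> {..<m}"
        then obtain i where "i < n" "A i = Some h" using assms(2) by auto
        then show "h \<in> (\<lambda>i. the (A i)) ` ?S" by (intro image_eqI[of _ _ i]) auto
      qed
    qed
    ultimately show "bij_betw (\<lambda>i. the (A i)) ?S {..<m}" by (simp add: bij_betw_def)
  qed
  finally show ?thesis .
qed

text \<open>For \<open>m < n\<close> this is a case of the definition. For \<open>m = n\<close> the
  definition asks for every agent to be served instead; both requirements agree because an injective
  self-map of a finite set is surjective, applied to agents in one direction and to houses in the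
  other.\<close>

lemma complete_allocation_iff:
  fixes n m :: nat
  assumes "m \<le> n"
  shows "complete_allocation {..<n} {..<m} A \<longleftrightarrow>
    is_allocation {..<n} {..<m} A \<and> (\<forall>h<m. \<exists>i<n. A i = Some h)"
proof (cases "is_allocation {..<n} {..<m} A \<and> n \<le> m")
  case False
  then show ?thesis using assms by (auto simp: complete_allocation_def Bex_def)
next
  case True
  then have nm: "n = m" and alloc: "is_allocation {..<n} {..<m} A" using assms by auto
  have "(\<forall>i<n. \<exists>h<n. A i = Some h) \<longleftrightarrow> (\<forall>h<n. \<exists>i<n. A i = Some h)"
  proof
    assume all: "\<forall>i<n. \<exists>h<n. A i = Some h"
    then obtain a where a: "\<And>i. i < n \<Longrightarrow> a i < n \<and> A i = Some (a i)" by metis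
    have "inj_on a {..<n}"
    proof (rule inj_onI)
      fix i j assume "i \<in> {..<n}" "j \<in> {..<n}" "a i = a j"
      then show "i = j" using alloc a[of i] a[of j] by (simp add: is_allocation_def)
    qed
    moreover have "a ` {..<n} \<subseteq> {..<n}" using a by auto
    ultimately have im: "a ` {..<n} = {..<n}" by (simp add: endo_inj_surj)
    show "\<forall>h<n. \<exists>i<n. A i = Some h"
    proof (intro allI impI)
      fix h assume "h < n"
      then obtain i where "i < n" "h = a i" using im by blast
      then show "\<exists>i<n. A i = Some h" using a by auto
    qed
  next
    assume all: "\<forall>h<n. \<exists>i<n. A i = Some h"
    then obtain a where a: "\<And>h. h < n \<Longrightarrow> a h < n \<and> A (a h) = Some h" by metis
    have "inj_on a {..<n}"
    proof (rule inj_onI)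
      fix h h' assume "h \<in> {..<n}" "h' \<in> {..<n}" "a h = a h'"
      then have "Some h = Some h'" using a by (metis lessThan_iff)
      then show "h = h'" by simp
    qed
    moreover have "a ` {..<n} \<subseteq> {..<n}" using a by auto
    ultimately have im: "a ` {..<n} = {..<n}" by (simp add: endo_inj_surj)
    show "\<forall>i<n. \<exists>h<n. A i = Some h"
    proof (intro allI impI)
      fix i assume "i < n"
      then obtain h where "h < n" "i = a h" using im by blast
      then show "\<exists>h<n. A i = Some h" using a by auto
    qed
  qed
  then show ?thesis using alloc by (auto simp: complete_allocation_def nm)
qed

text \<open>Since all houses are assigned, the envy of one agent is a sum over houses, independent
  of who holds them. Nonnegative valuations deal with the empty assignment: agents without a house
  are not envied, and such an agent has own value 0, so its sum of minima vanishes.\<close>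

lemma total_envy_eq:
  fixes n m :: nat
  assumes alloc: "is_allocation {..<n} {..<m} A" "\<forall>h<m. \<exists>i<n. A i = Some h"
    and v: "\<forall>i<n. \<forall>h<m. 0 \<le> v i h"
  shows "total_envy {..<n} v A = (\<Sum>i<n. \<Sum>h<m. v i h) -
    (\<Sum>i<n. case A i of None \<Rightarrow> 0 | Some h \<Rightarrow> \<Sum>h'<m. min (v i h) (v i h'))"
proof -
  have "(\<Sum>j<n. max (bundle_value v i (A j) - bundle_value v i (A i)) 0) =
    (\<Sum>h<m. v i h) - (case A i of None \<Rightarrow> 0 | Some h \<Rightarrow> \<Sum>h'<m. min (v i h) (v i h'))"
    if i: "i < n" for i
  proof -
    define x where "x = bundle_value v i (A i)"
    have x: "0 \<le> x" using alloc(1) v i by (auto simp: x_def bundle_value_def is_allocation_def split: option.splits)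
    have "(\<Sum>j<n. max (bundle_value v i (A j) - x) 0) =
        (\<Sum>j<n. case A j of None \<Rightarrow> 0 | Some h \<Rightarrow> max (v i h - x) 0)"
      using x by (intro sum.cong) (auto simp: bundle_value_def split: option.splits)
    also have "\<dots> = (\<Sum>h<m. max (v i h - x) 0)" by (rule sum_assigned_houses[OF alloc])
    also have "\<dots> = (\<Sum>h<m. v i h - min x (v i h))" by (intro sum.cong) auto
    also have "\<dots> = (\<Sum>h<m. v i h) - (\<Sum>h<m. min x (v i h))" by (rule sum_subtractf)
    also have "(\<Sum>h<m. min x (v i h)) = (case A i of None \<Rightarrow> 0 | Some h \<Rightarrow> \<Sum>h'<m. min (v i h) (v i h'))"
      using v i by (auto simp: x_def bundle_value_def split: option.splits)
    finally show ?thesis unfolding x_def .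
  qed
  then show ?thesis by (simp add: total_envy_def sum_subtractf)
qed

text \<open>Feasibility bounds the weight of any complete allocation by the sum of \<open>u\<close>
  over all houses plus the sum of \<open>w\<close> over all agents. The output attains this bound:
  its edges are tight, and agents without a house have \<open>w\<close> zero.\<close>

lemma matching_optimal:
  assumes mn: "m \<le> n" and v: "\<forall>i<n. \<forall>h<m. 0 \<le> v i h"
    and match: "weights.matching n m (\<lambda>i h. \<Sum>h'<m. min (v i h) (v i h')) m (nats s ''out'') u w"
  shows "is_arg_min (total_envy {..<n} v) (complete_allocation {..<n} {..<m}) (output_allocation s)"
proof -
  let ?g = "\<lambda>i h. \<Sum>h'<m. min (v i h) (v i h')"
  let ?p = "nats s ''out''" and ?O = "output_allocation s"
  note M = match[unfolded weights.matching_def weights.feasible_def]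
  have O: "?O i = (if ?p i = 0 then None else Some (?p i - 1))" for i
    by (simp add: output_allocation_def Let_def)
  have O_alloc: "is_allocation {..<n} {..<m} ?O"
    unfolding is_allocation_def
  proof (intro conjI ballI allI impI)
    fix i h assume "i \<in> {..<n}" "?O i = Some h"
    then have "i < n" "?p i = Suc h" by (auto simp: O split: if_splits)
    then show "h \<in> {..<m}" using M by (metis Suc_le_lessD lessThan_iff)
  next
    fix i j h assume "i \<in> {..<n}" "j \<in> {..<n}" "?O i = Some h \<and> ?O j = Some h"
    then have "i < n" "j < n" "?p i = Suc h" "?p j = Suc h" by (auto simp: O split: if_splits)
    then show "i = j" using M by (metis nat.distinct(1))
  qed
  have O_all: "\<forall>h<m. \<exists>i<n. ?O i = Some h"
  proof (intro allI impI)
    fix h assume "h < m"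
    then obtain i where "i < n" "?p i = Suc h" using M by blast
    then show "\<exists>i<n. ?O i = Some h" by (intro exI[of _ i]) (auto simp: O)
  qed
  have "total_envy {..<n} v ?O \<le> total_envy {..<n} v A" if A: "complete_allocation {..<n} {..<m} A" for A
  proof -
    have A': "is_allocation {..<n} {..<m} A" "\<forall>h<m. \<exists>i<n. A i = Some h"
      using A by (simp_all add: complete_allocation_iff[OF mn])
    have "(\<Sum>i<n. case A i of None \<Rightarrow> 0 | Some h \<Rightarrow> ?g i h) \<le> (\<Sum>i<n. (case A i of None \<Rightarrow> 0 | Some h \<Rightarrow> u h) + w i)"
    proof (rule sum_mono)
      fix i assume "i \<in> {..<n}"
      then have i: "i < n" by simp
      have "h < m" if "A i = Some h" for h using A'(1) that i by (auto simp: is_allocation_def)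
      then show "(case A i of None \<Rightarrow> 0 | Some h \<Rightarrow> ?g i h) \<le> (case A i of None \<Rightarrow> 0 | Some h \<Rightarrow> u h) + w i"
        using M i by (auto split: option.splits)
    qed
    also have "\<dots> = (\<Sum>h<m. u h) + (\<Sum>i<n. w i)"
      by (simp add: sum.distrib sum_assigned_houses[OF A'])
    also have "\<dots> = (\<Sum>i<n. (case ?O i of None \<Rightarrow> 0 | Some h \<Rightarrow> u h) + w i)"
      by (simp add: sum.distrib sum_assigned_houses[OF O_alloc O_all])
    also have "\<dots> = (\<Sum>i<n. case ?O i of None \<Rightarrow> 0 | Some h \<Rightarrow> ?g i h)"
      using M by (intro sum.cong refl) (auto simp: O)
    finally show ?thesis
      by (simp add: total_envy_eq[OF A' v] total_envy_eq[OF O_alloc O_all v])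
  qed
  moreover have "complete_allocation {..<n} {..<m} ?O"
    using O_alloc O_all by (simp add: complete_allocation_iff[OF mn])
  ultimately show ?thesis by (auto simp: is_arg_min_def not_less)
qed

section \<open>The Hungarian method as a program\<close>

abbreviation NVar :: "vname \<Rightarrow> nexp" where "NVar x \<equiv> NRead x (NConst 0)"
abbreviation VVar :: "vname \<Rightarrow> vexp" where "VVar x \<equiv> VRead x (NConst 0)"
abbreviation LSet :: "vname \<Rightarrow> nexp \<Rightarrow> lcom" where "LSet x e \<equiv> LNat x (NConst 0) e"

text \<open>A table of the multiples of \<open>m\<close>, built by repeated addition, replaces the
  multiplication in row-major addresses.\<close>

definition offset_prog :: lcom where
  "offset_prog = LFor ''i'' ''n'' 0
     (LNat ''offset'' (NPlus (NVar ''i'') (NConst 1)) (NPlus (NRead ''offset'' (NVar ''i'')) (NVar ''m'')))"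

abbreviation entry :: "vname \<Rightarrow> vexp" where
  "entry x \<equiv> VRead ''v'' (NPlus (NRead ''offset'' (NVar ''i'')) (NVar x))"

definition min_sum_prog :: lcom where
  "min_sum_prog = LFor ''g'' ''m'' 0
     (LCond (VLess (entry ''h'') (entry ''g''))
       (LVal ''acc'' (NConst 0) (VPlus (VVar ''acc'') (entry ''h'')))
       (LVal ''acc'' (NConst 0) (VPlus (VVar ''acc'') (entry ''g''))))"

text \<open>Besides storing the weights, the loop adds them up in \<open>u\<close>. Weights are
  nonnegative, so a column sum dominates each of its entries and yields initial feasible potentials
  together with \<open>w = 0\<close>.\<close>

definition row_prog :: lcom where
  "row_prog = LFor ''h'' ''m'' 0
     (LSeq (LVal ''acc'' (NConst 0) VZero)
     (LSeq min_sum_prog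
     (LSeq (LVal ''G'' (NPlus (NRead ''offset'' (NVar ''i'')) (NVar ''h'')) (VVar ''acc''))
       (LVal ''u'' (NVar ''h'') (VPlus (VRead ''u'' (NVar ''h'')) (VVar ''acc''))))))"

definition weight_prog :: lcom where
  "weight_prog = LFor ''i'' ''n'' 0 row_prog"

abbreviation slack_exp :: vexp where
  "slack_exp \<equiv>
     VMinus (VPlus (VRead ''u'' (NMinus (NRead ''out'' (NVar ''c'')) (NConst 1))) (VRead ''w'' (NVar ''j'')))
       (VRead ''G'' (NPlus (NRead ''offset'' (NVar ''j'')) (NMinus (NRead ''out'' (NVar ''c'')) (NConst 1))))"

text \<open>There is no infinite value with which to start the minimum, hence the flag
  \<open>found\<close>. In the absence of disjunction, the nested negation expresses that no
  candidate has been seen or that the current slack is smaller.\<close>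

definition scan_prog :: lcom where
  "scan_prog = LFor ''j'' ''n'' 0
     (LCond (BAnd (NLess (NConst 0) (NRead ''used'' (NVar ''c'')))
        (BAnd (NLess (NRead ''used'' (NVar ''j'')) (NConst 1))
          (BNot (BAnd (NLess (NConst 0) (NVar ''found'')) (BNot (VLess slack_exp (VVar ''delta'')))))))
       (LSeq (LVal ''delta'' (NConst 0) slack_exp)
       (LSeq (LSet ''found'' (NConst 1))
       (LSeq (LSet ''from'' (NVar ''c''))
         (LSet ''to'' (NVar ''j'')))))
       LSkip)"

definition search_prog :: lcom where
  "search_prog = LSeq (LSet ''found'' (NConst 0)) (LFor ''c'' ''n'' 1 scan_prog)"

text \<open>The loop includes the index \<open>n\<close> because the house of the root must be
  shifted too. The entry of \<open>w\<close> at \<open>n\<close> changes as well, but it belongs to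
  no real agent and no condition on potentials mentions it.\<close>

definition shift_prog :: lcom where
  "shift_prog = LFor ''j'' ''n'' 1
     (LCond (NLess (NConst 0) (NRead ''used'' (NVar ''j'')))
       (LSeq (LVal ''u'' (NMinus (NRead ''out'' (NVar ''j'')) (NConst 1))
               (VMinus (VRead ''u'' (NMinus (NRead ''out'' (NVar ''j'')) (NConst 1))) (VVar ''delta'')))
         (LVal ''w'' (NVar ''j'') (VPlus (VRead ''w'' (NVar ''j'')) (VVar ''delta''))))
       LSkip)"

text \<open>The root has rank 1 and rounds are counted from 0, which explains the rank
  \<open>l + 2\<close> of the new agent.\<close>

definition grow_prog :: lcom where
  "grow_prog =
     LSeq search_prog
     (LSeq shift_prog
     (LSeq (LNat ''used'' (NVar ''to'') (NPlus (NVar ''l'') (NConst 2)))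
     (LSeq (LNat ''way'' (NVar ''to'') (NVar ''from''))
       (LCond (NLess (NRead ''out'' (NVar ''to'')) (NConst 1))
         (LSeq (LSet ''done'' (NConst 1)) (LSet ''cur'' (NVar ''to'')))
         LSkip))))"

text \<open>A bounded loop cannot be left early. After success the flag \<open>done\<close> turns
  the remaining rounds into idle ones, as the comparison of \<open>cur\<close> with \<open>n\<close>
  does in \<open>augment_prog\<close>.\<close>

definition tree_prog :: lcom where
  "tree_prog =
     LSeq (LFor ''j'' ''n'' 0 (LNat ''used'' (NVar ''j'') (NConst 0)))
     (LSeq (LNat ''used'' (NVar ''n'') (NConst 1))
     (LSeq (LNat ''out'' (NVar ''n'') (NPlus (NVar ''k'') (NConst 1)))
     (LSeq (LSet ''done'' (NConst 0))
       (LFor ''l'' ''n'' 0 (LCond (NLess (NVar ''done'') (NConst 1)) grow_prog LSkip)))))"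

definition augment_prog :: lcom where
  "augment_prog = LFor ''l'' ''n'' 0
     (LCond (NLess (NVar ''cur'') (NVar ''n''))
       (LSeq (LNat ''out'' (NVar ''cur'') (NRead ''out'' (NRead ''way'' (NVar ''cur''))))
         (LSet ''cur'' (NRead ''way'' (NVar ''cur''))))
       LSkip)"

definition main_prog :: lcom where
  "main_prog = LSeq offset_prog (LSeq weight_prog (LFor ''k'' ''m'' 0 (LSeq tree_prog augment_prog)))"

lemmas prog_defs = offset_prog_def min_sum_prog_def row_prog_def weight_prog_def scan_prog_def
  search_prog_def shift_prog_def grow_prog_def tree_prog_def augment_prog_def main_prog_def

section \<open>Correctness of the weight table and of the edge search\<close>

lemma run_offset_prog:
  assumes "nats s ''offset'' 0 = 0"
  shows "\<forall>i\<le>nats s ''n'' 0. nats (run offset_prog s) ''offset'' i = i * nats s ''m'' 0"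
proof -
  let ?I = "\<lambda>k s'. \<forall>i\<le>k. nats s' ''offset'' i = i * nats s ''m'' 0"
  have "?I (nats s ''n'' 0 + 0) (run offset_prog s)"
    unfolding offset_prog_def
  proof (rule run_LFor[where I = ?I], goal_cases)
    case (4 k s')
    have "nats s' ''m'' = nats s ''m''" by (rule 4) simp
    then show ?case using 4(2,5) by (auto simp: le_Suc_eq)
  qed (use assms in simp_all)
  then show ?thesis by simp
qed

lemma run_min_sum_prog:
  defines "a \<equiv> \<lambda>s x. vals s ''v'' (nats s ''offset'' (nats s ''i'' 0) + x)"
  shows "vals (run min_sum_prog s) ''acc'' 0 =
    vals s ''acc'' 0 + (\<Sum>x<nats s ''m'' 0. min (a s (nats s ''h'' 0)) (a s x))"
proof -
  let ?I = "\<lambda>k s'. vals s' ''acc'' 0 = vals s ''acc'' 0 + (\<Sum>x<k. min (a s (nats s ''h'' 0)) (a s x))"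
  have "?I (nats s ''m'' 0 + 0) (run min_sum_prog s)"
    unfolding min_sum_prog_def
  proof (rule run_LFor[where I = ?I], goal_cases)
    case (4 k s')
    have "nats s' ''h'' = nats s ''h''" "nats s' ''i'' = nats s ''i''" "nats s' ''offset'' = nats s ''offset''"
      "vals s' ''v'' = vals s ''v''" by (rule 4; simp)+
    then show ?case using 4(2,5) by (auto simp: a_def min_def)
  qed simp_all
  then show ?thesis by simp
qed

text \<open>Preserving the cells of \<open>G\<close> before the current row suffices because rows
  are filled in increasing order.\<close>

lemma run_row_prog:
  defines "b \<equiv> \<lambda>s. nats s ''offset'' (nats s ''i'' 0)"
  defines "gw \<equiv> \<lambda>s h. \<Sum>x<nats s ''m'' 0. min (vals s ''v'' (b s + h)) (vals s ''v'' (b s + x))"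
  shows "\<forall>h<nats s ''m'' 0. vals (run row_prog s) ''G'' (b s + h) = gw s h"
    and "\<forall>j<b s. vals (run row_prog s) ''G'' j = vals s ''G'' j"
    and "\<forall>h<nats s ''m'' 0. vals (run row_prog s) ''u'' h = vals s ''u'' h + gw s h"
proof -
  let ?I = "\<lambda>k s'. (\<forall>h<k. vals s' ''G'' (b s + h) = gw s h) \<and>
    (\<forall>j<b s. vals s' ''G'' j = vals s ''G'' j) \<and>
    (\<forall>h. vals s' ''u'' h = vals s ''u'' h + (if h < k then gw s h else 0))"
  have "?I (nats s ''m'' 0 + 0) (run row_prog s)"
    unfolding row_prog_def
  proof (rule run_LFor[where I = ?I], goal_cases)
    case (4 k s')
    have fr: "nats s' ''i'' = nats s ''i''" "nats s' ''offset'' = nats s ''offset''" "nats s' ''m'' = nats s ''m''"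
      "vals s' ''v'' = vals s ''v''" by (rule 4; simp add: min_sum_prog_def)+
    define s1 where "s1 = vupdate ''acc'' 0 0 s'"
    have acc: "vals (run min_sum_prog s1) ''acc'' 0 = gw s k"
      unfolding run_min_sum_prog using 4(2) fr by (simp add: s1_def gw_def b_def)
    have fr1: "nats (run min_sum_prog s1) y = nats s' y" if "y \<noteq> ''g''" for y
      using that by (subst nats_run) (simp_all add: min_sum_prog_def s1_def)
    have fr2: "vals (run min_sum_prog s1) y = vals s' y" if "y \<noteq> ''acc''" for y
      using that by (subst vals_run) (simp_all add: min_sum_prog_def s1_def)
    show ?case using 4(2,5) fr acc
      by (simp add: s1_def[symmetric] fr1 fr2 b_def less_Suc_eq)
  qed (simp_all add: min_sum_prog_def)
  then show "\<forall>h<nats s ''m'' 0. vals (run row_prog s) ''G'' (b s + h) = gw s h"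
    "\<forall>j<b s. vals (run row_prog s) ''G'' j = vals s ''G'' j"
    "\<forall>h<nats s ''m'' 0. vals (run row_prog s) ''u'' h = vals s ''u'' h + gw s h"
    by simp_all
qed

lemma run_weight_prog:
  assumes n: "nats s ''n'' 0 = n" and m: "nats s ''m'' 0 = m"
    and off: "\<forall>i\<le>n. nats s ''offset'' i = i * m"
    and u: "\<forall>h<m. vals s ''u'' h = 0"
    and v: "\<forall>i<n. \<forall>h<m. vals s ''v'' (i * m + h) = v i h"
  defines "gw \<equiv> \<lambda>i h. \<Sum>x<m. min (v i h) (v i x)"
  shows "\<forall>i<n. \<forall>h<m. vals (run weight_prog s) ''G'' (i * m + h) = gw i h"
    and "\<forall>h<m. vals (run weight_prog s) ''u'' h = (\<Sum>i<n. gw i h)"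
proof -
  let ?I = "\<lambda>k s'. (\<forall>i<k. \<forall>h<m. vals s' ''G'' (i * m + h) = gw i h) \<and>
    (\<forall>h<m. vals s' ''u'' h = (\<Sum>i<k. gw i h))"
  have "?I (nats s ''n'' 0 + 0) (run weight_prog s)"
    unfolding weight_prog_def
  proof (rule run_LFor[where I = ?I], goal_cases)
    case (4 k s')
    have fr: "nats s' ''offset'' = nats s ''offset''" "nats s' ''m'' = nats s ''m''"
      "vals s' ''v'' = vals s ''v''" by (rule 4; simp add: prog_defs)+
    have k: "k < n" using 4(1) n by simp
    then have b: "nats s' ''offset'' (nats s' ''i'' 0) = k * m" using 4(2) off fr by simp
    have eq: "(\<Sum>x<nats s' ''m'' 0. min (vals s' ''v'' (k * m + h)) (vals s' ''v'' (k * m + x))) = gw k h"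
      if "h < m" for h
      using v k that by (simp add: fr m gw_def)
    have less: "i * m + h < k * m" if "i < k" "h < m" for i h
    proof -
      have "i * m + h < Suc i * m" using that by simp
      also have "\<dots> \<le> k * m" using that by (intro mult_right_mono) auto
      finally show ?thesis .
    qed
    have m': "nats s' ''m'' 0 = m" by (simp add: fr m)
    note R = run_row_prog[of s', unfolded b m']
    have "vals (run row_prog s') ''G'' (i * m + h) = gw i h" if "i < Suc k" "h < m" for i h
    proof (cases "i = k")
      case True
      then show ?thesis using R(1) eq that m' by simp
    next
      case False
      then have "i < k" using that by simp
      then show ?thesis using R(2) less that 4(5) by simp
    qed
    moreover have "vals (run row_prog s') ''u'' h = (\<Sum>i<Suc k. gw i h)" if "h < m" for h
      using R(3) eq that 4(5) m' by simp
    ultimately show ?case by simp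
  qed (use u in \<open>simp_all add: prog_defs\<close>)
  then show "\<forall>i<n. \<forall>h<m. vals (run weight_prog s) ''G'' (i * m + h) = gw i h"
    "\<forall>h<m. vals (run weight_prog s) ''u'' h = (\<Sum>i<n. gw i h)"
    using n by simp_all
qed

text \<open>The flag \<open>f\<close> is \<open>0\<close> as long as no candidate edge has been seen; \<open>d\<close>, \<open>c\<close>, \<open>j\<close> are then arbitrary.\<close>

definition best_edge :: "nat \<Rightarrow> (nat \<Rightarrow> nat) \<Rightarrow> (nat \<Rightarrow> nat \<Rightarrow> real) \<Rightarrow> (nat \<Rightarrow> nat \<Rightarrow> bool) \<Rightarrow>
    nat \<Rightarrow> real \<Rightarrow> nat \<Rightarrow> nat \<Rightarrow> bool" where
  "best_edge n r \<sigma> D f d c j \<longleftrightarrow>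
     (\<forall>a\<le>n. \<forall>b<n. D a b \<longrightarrow> r a \<noteq> 0 \<longrightarrow> r b = 0 \<longrightarrow> f \<noteq> 0 \<and> d \<le> \<sigma> a b) \<and>
     (f \<noteq> 0 \<longrightarrow> c \<le> n \<and> r c \<noteq> 0 \<and> j < n \<and> r j = 0 \<and> d = \<sigma> c j)"

text \<open>\<open>D\<close> is the set of pairs already examined, to which \<open>D'\<close> adds
  at most the current one. The recorded slack was minimal on \<open>D\<close>, so a smaller slack is
  minimal on \<open>D'\<close>.\<close>

lemma best_edge_update:
  assumes "best_edge n r \<sigma> D f d c j" "a \<le> n" "b < n" "r a \<noteq> 0" "r b = 0" "f = 0 \<or> \<sigma> a b < d"
    and "\<And>a' b'. D' a' b' \<Longrightarrow> D a' b' \<or> a' = a \<and> b' = b"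
  shows "best_edge n r \<sigma> D' 1 (\<sigma> a b) a b"
  unfolding best_edge_def
proof (intro conjI impI allI)
  fix a' b' assume ab: "a' \<le> n" "b' < n" "D' a' b'" "r a' \<noteq> 0" "r b' = 0"
  show "\<sigma> a b \<le> \<sigma> a' b'"
  proof (cases "D a' b'")
    case True
    then have "f \<noteq> 0" "d \<le> \<sigma> a' b'" using assms(1) ab unfolding best_edge_def by blast+
    then show ?thesis using assms(6) by simp
  next
    case False
    then show ?thesis using assms(7)[OF ab(3)] by auto
  qed
qed (use assms(2-5) in auto)

lemma best_edge_skip:
  assumes "best_edge n r \<sigma> D f d c j" "\<not> (r a \<noteq> 0 \<and> r b = 0 \<and> (f = 0 \<or> \<sigma> a b < d))"
    and "\<And>a' b'. D' a' b' \<Longrightarrow> D a' b' \<or> a' = a \<and> b' = b"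
  shows "best_edge n r \<sigma> D' f d c j"
  unfolding best_edge_def
proof (intro conjI)
  show "\<forall>a\<le>n. \<forall>b<n. D' a b \<longrightarrow> r a \<noteq> 0 \<longrightarrow> r b = 0 \<longrightarrow> f \<noteq> 0 \<and> d \<le> \<sigma> a b"
  proof (intro allI impI)
    fix a' b' assume ab: "a' \<le> n" "b' < n" "D' a' b'" "r a' \<noteq> 0" "r b' = 0"
    show "f \<noteq> 0 \<and> d \<le> \<sigma> a' b'"
    proof (cases "D a' b'")
      case True
      then show ?thesis using assms(1) ab unfolding best_edge_def by blast
    next
      case False
      then show ?thesis using assms(3)[OF ab(3)] assms(2) ab by auto
    qed
  qed
  show "f \<noteq> 0 \<longrightarrow> c \<le> n \<and> r c \<noteq> 0 \<and> j < n \<and> r j = 0 \<and> d = \<sigma> c j"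
    using assms(1) unfolding best_edge_def by blast
qed

lemma best_edge_mono:
  assumes "best_edge n r \<sigma> D f d c j" "\<And>a b. a \<le> n \<Longrightarrow> b < n \<Longrightarrow> D' a b \<Longrightarrow> D a b"
  shows "best_edge n r \<sigma> D' f d c j"
  using assms unfolding best_edge_def by blast

definition slack :: "state \<Rightarrow> nat \<Rightarrow> nat \<Rightarrow> real" where
  "slack s c j = vals s ''u'' (nats s ''out'' c - 1) + vals s ''w'' j
     - vals s ''G'' (nats s ''offset'' j + (nats s ''out'' c - 1))"

abbreviation best_state :: "state \<Rightarrow> (nat \<Rightarrow> nat \<Rightarrow> bool) \<Rightarrow> state \<Rightarrow> bool" where
  "best_state s D s' \<equiv> best_edge (nats s ''n'' 0) (nats s ''used'') (slack s) D
     (nats s' ''found'' 0) (vals s' ''delta'' 0) (nats s' ''from'' 0) (nats s' ''to'' 0)"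

lemma run_scan_prog:
  assumes "best_state s (\<lambda>a b. a < c) s" "nats s ''c'' 0 = c" "c \<le> nats s ''n'' 0"
  shows "best_state s (\<lambda>a b. a < Suc c) (run scan_prog s)"
proof -
  \<comment> \<open>Pairs are examined in lexicographic order: all rows before \<open>c\<close>, and
    row \<open>c\<close> up to column \<open>k\<close>.\<close>
  let ?D = "\<lambda>k a b. a < c \<or> a = c \<and> b < k"
  let ?I = "\<lambda>k s'. best_state s (?D k) s'"
  have "?I (nats s ''n'' 0 + 0) (run scan_prog s)"
    unfolding scan_prog_def
  proof (rule run_LFor[where I = ?I], goal_cases)
    case 3
    then show ?case using assms by simp
  next
    case (4 k s')
    have fr: "nats s' ''used'' = nats s ''used''" "nats s' ''out'' = nats s ''out''"
      "nats s' ''offset'' = nats s ''offset''" "nats s' ''c'' = nats s ''c''"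
      "vals s' ''u'' = vals s ''u''" "vals s' ''w'' = vals s ''w''" "vals s' ''G'' = vals s ''G''"
      by (rule 4; simp)+
    have k: "k < nats s ''n'' 0" using 4(1) by simp
    have D: "?D (Suc k) a b \<Longrightarrow> ?D k a b \<or> a = c \<and> b = k" for a b by auto
    have sl: "vval s' slack_exp = slack s c k"
      using 4(2) assms(2) by (simp add: slack_def fr)
    show ?case
    proof (cases "nats s ''used'' c \<noteq> 0 \<and> nats s ''used'' k = 0 \<and>
        (nats s' ''found'' 0 = 0 \<or> slack s c k < vals s' ''delta'' 0)")
      case True
      note best_edge_update[OF 4(5) assms(3) k _ _ _ D]
      with True show ?thesis
        using 4(2) assms(2) sl by (simp add: fr)
    next
      case False
      note best_edge_skip[OF 4(5) False D]
      with False show ?thesis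
        using 4(2) assms(2) sl by (auto simp: fr)
    qed
  qed simp_all
  then show ?thesis by (rule best_edge_mono) (simp add: less_Suc_eq)
qed

lemma run_search_prog: "best_state s (\<lambda>_ _. True) (run search_prog s)"
proof -
  define s0 where "s0 = nupdate ''found'' 0 0 s"
  let ?I = "\<lambda>k s'. best_state s (\<lambda>a b. a < k) s'"
  have "?I (nats s0 ''n'' 0 + 1) (run (LFor ''c'' ''n'' 1 scan_prog) s0)"
  proof (rule run_LFor[where I = ?I], goal_cases)
    case 3
    then show ?case by (simp add: s0_def best_edge_def)
  next
    case (4 k s')
    have fr: "nats s' ''n'' = nats s ''n''" "nats s' ''used'' = nats s ''used''" "nats s' ''out'' = nats s ''out''"
      "nats s' ''offset'' = nats s ''offset''"
      "vals s' ''u'' = vals s ''u''" "vals s' ''w'' = vals s ''w''" "vals s' ''G'' = vals s ''G''"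
      using 4(3)[of "''n''"] 4(3)[of "''used''"] 4(3)[of "''out''"] 4(3)[of "''offset''"]
        4(4)[of "''u''"] 4(4)[of "''w''"] 4(4)[of "''G''"]
      by (simp_all add: scan_prog_def s0_def)
    have "slack s' = slack s" by (simp add: fun_eq_iff slack_def fr)
    then have "best_state s (\<lambda>a b. a < Suc k) (run scan_prog s')"
      using run_scan_prog[of s' k] 4(1,2,5) by (simp add: fr s0_def)
    then show ?case by simp
  qed (simp_all add: scan_prog_def)
  then have "best_state s (\<lambda>a b. a < Suc (nats s ''n'' 0)) (run search_prog s)"
    by (simp add: search_prog_def s0_def Suc_eq_plus1 del: run.simps(6))
  then show ?thesis by (rule best_edge_mono) simp
qed

text \<open>The loop visits agents, but \<open>u\<close> is indexed by houses. Injectivity ensures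
  that a house is lowered only once, and nonzero entries prevent the truncated difference
  \<open>0 - 1\<close> from hitting house 0.\<close>

lemma run_shift_prog:
  assumes nz: "\<And>j. j \<le> nats s ''n'' 0 \<Longrightarrow> nats s ''used'' j \<noteq> 0 \<Longrightarrow> nats s ''out'' j \<noteq> 0"
    and inj: "\<And>i j. i \<le> nats s ''n'' 0 \<Longrightarrow> j \<le> nats s ''n'' 0 \<Longrightarrow> nats s ''used'' i \<noteq> 0 \<Longrightarrow>
      nats s ''used'' j \<noteq> 0 \<Longrightarrow> nats s ''out'' i = nats s ''out'' j \<Longrightarrow> i = j"
  shows "vals (run shift_prog s) ''u'' h = vals s ''u'' h -
      (if \<exists>j\<le>nats s ''n'' 0. nats s ''used'' j \<noteq> 0 \<and> nats s ''out'' j = Suc h then vals s ''delta'' 0 else 0)"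
    and "vals (run shift_prog s) ''w'' j = vals s ''w'' j +
      (if j \<le> nats s ''n'' 0 \<and> nats s ''used'' j \<noteq> 0 then vals s ''delta'' 0 else 0)"
proof -
  define E where "E = (\<lambda>k h. \<exists>j<k. nats s ''used'' j \<noteq> 0 \<and> nats s ''out'' j = Suc h)"
  let ?I = "\<lambda>k s'. (\<forall>h. vals s' ''u'' h = vals s ''u'' h - (if E k h then vals s ''delta'' 0 else 0)) \<and>
    (\<forall>j. vals s' ''w'' j = vals s ''w'' j +
      (if j < k \<and> nats s ''used'' j \<noteq> 0 then vals s ''delta'' 0 else 0))"
  have "?I (nats s ''n'' 0 + 1) (run shift_prog s)"
    unfolding shift_prog_def
  proof (rule run_LFor[where I = ?I], goal_cases)
    case 3
    then show ?case by (simp add: E_def)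
  next
    case (4 k s')
    have fr: "nats s' ''used'' = nats s ''used''" "nats s' ''out'' = nats s ''out''"
      "vals s' ''delta'' = vals s ''delta''" by (rule 4; simp)+
    show ?case
    proof (cases "nats s ''used'' k = 0")
      case True
      then have "E (Suc k) = E k" by (auto simp: E_def less_Suc_eq fun_eq_iff)
      then show ?thesis using 4(2,5) True by (simp add: fr less_Suc_eq conj_disj_distribR)
    next
      case False
      have k: "k \<le> nats s ''n'' 0" using 4(1) by simp
      obtain h0 where h0: "nats s ''out'' k = Suc h0" using nz[OF k False] by (cases "nats s ''out'' k") auto
      have "\<not> E k h0"
      proof
        assume "E k h0"
        then obtain j where "j < k" "nats s ''used'' j \<noteq> 0" "nats s ''out'' j = Suc h0" by (auto simp: E_def)
        then show False using inj[of j k] k False h0 by simp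
      qed
      moreover have "E (Suc k) h \<longleftrightarrow> h = h0 \<or> E k h" for h
        using False h0 by (auto simp: E_def less_Suc_eq)
      ultimately show ?thesis using 4(2,5) False h0 by (simp add: fr less_Suc_eq)
    qed
  qed simp_all
  then show "vals (run shift_prog s) ''u'' h = vals s ''u'' h -
      (if \<exists>j\<le>nats s ''n'' 0. nats s ''used'' j \<noteq> 0 \<and> nats s ''out'' j = Suc h then vals s ''delta'' 0 else 0)"
    "vals (run shift_prog s) ''w'' j = vals s ''w'' j +
      (if j \<le> nats s ''n'' 0 \<and> nats s ''used'' j \<noteq> 0 then vals s ''delta'' 0 else 0)"
    by (simp_all add: E_def less_Suc_eq_le flip: Suc_eq_plus1)
qed

section \<open>Correctness of search, augmentation and phases\<close>

context weights
begin

definition loaded :: "state \<Rightarrow> bool" where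
  "loaded s \<longleftrightarrow> nats s ''n'' 0 = n \<and> nats s ''m'' 0 = m \<and> (\<forall>i<n. nats s ''offset'' i = i * m) \<and>
     (\<forall>i<n. \<forall>h<m. vals s ''G'' (i * m + h) = g i h)"

text \<open>After success the tree is frozen while \<open>l\<close> runs on, so the count in
  \<open>growing\<close> is given up; what remains is that \<open>cur\<close> is an agent of the
  tree without a house.\<close>

definition tree_state :: "nat \<Rightarrow> nat \<Rightarrow> state \<Rightarrow> bool" where
  "tree_state k l s \<longleftrightarrow>
     search_tree k l (nats s ''out'') (vals s ''u'') (vals s ''w'') (nats s ''used'') (nats s ''way'') \<and>
     (nats s ''done'' 0 = 0 \<longrightarrow> growing l (nats s ''out'') (nats s ''used'')) \<and>
     (nats s ''done'' 0 \<noteq> 0 \<longrightarrow> nats s ''cur'' 0 < n \<and> nats s ''used'' (nats s ''cur'' 0) \<noteq> 0 \<and>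
        nats s ''out'' (nats s ''cur'' 0) = 0)"

abbreviation matching_state :: "nat \<Rightarrow> state \<Rightarrow> bool" where
  "matching_state k s \<equiv> matching k (nats s ''out'') (vals s ''u'') (vals s ''w'')"

lemma loaded_frame:
  assumes "loaded s" "nats s' ''n'' = nats s ''n''" "nats s' ''m'' = nats s ''m''"
    "nats s' ''offset'' = nats s ''offset''" "vals s' ''G'' = vals s ''G''"
  shows "loaded s'"
  using assms by (simp add: loaded_def)

lemma run_grow_prog:
  assumes load: "loaded s" and tree: "tree_state k l s" and active: "nats s ''done'' 0 = 0"
    and l: "nats s ''l'' 0 = l" "l < n" and k: "k < m"
  shows "tree_state k (Suc l) (run grow_prog s)"
proof -
  define s1 where "s1 = run search_prog s"
  define s2 where "s2 = run shift_prog s1"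
  define b where "b = nats s1 ''to'' 0"
  define c where "c = nats s1 ''from'' 0"
  define d where "d = vals s1 ''delta'' 0"
  let ?p = "nats s ''out''" and ?u = "vals s ''u''" and ?w = "vals s ''w''"
  let ?r = "nats s ''used''" and ?y = "nats s ''way''"
  have T: "search_tree k l ?p ?u ?w ?r ?y" and G: "growing l ?p ?r"
    using tree active by (simp_all add: tree_state_def)
  have n: "nats s ''n'' 0 = n" using load by (simp add: loaded_def)
  have fr1: "nats s1 y = nats s y" if "y \<notin> {''found'', ''from'', ''to'', ''c'', ''j''}" for y
    unfolding s1_def using that by (intro nats_run) (simp add: search_prog_def scan_prog_def)
  have fv1: "vals s1 y = vals s y" if "y \<noteq> ''delta''" for y
    unfolding s1_def using that by (intro vals_run) (simp add: search_prog_def scan_prog_def)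
  have fr2: "nats s2 y = nats s1 y" if "y \<noteq> ''j''" for y
    unfolding s2_def using that by (intro nats_run) (simp add: shift_prog_def)
  have best: "best_edge n ?r (slack s) (\<lambda>_ _. True) (nats s1 ''found'' 0) d c b"
    using run_search_prog[of s] by (simp add: s1_def b_def c_def d_def n)
  have rn: "?r n = 1" by (rule search_treeD(3)[OF T])
  \<comment> \<open>Some agent is still outside the tree; paired with the root it is a candidate
    edge, so the scan cannot come back empty.\<close>
  obtain b0 where "b0 < n" "?r b0 = 0" using growing_unused[OF G l(2) rn] by blast
  then have found: "nats s1 ''found'' 0 \<noteq> 0" using best rn by (force simp: best_edge_def)
  have slack: "slack s i j = ?u (?p i - 1) + ?w j - g j (?p i - 1)" if "i \<le> n" "j < n" for i j
  proof -
    have "?p i - 1 < m" using search_tree_le[OF T that(1)] k by simp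
    then show ?thesis using load that(2) by (simp add: slack_def loaded_def)
  qed
  have bc: "b < n" "?r b = 0" "c \<le> n" "?r c \<noteq> 0" "d = slack s c b"
    using best found by (simp_all add: best_edge_def)
  have nz: "?p j \<noteq> 0" if "j \<le> n" "?r j \<noteq> 0" for j
    using G that by (simp add: growing_def)
  have eq1: "nats s1 ''n'' 0 = n" "nats s1 ''used'' = ?r" "nats s1 ''out'' = ?p"
      "vals s1 ''u'' = ?u" "vals s1 ''w'' = ?w"
    by (simp_all add: fr1 fv1 n)
  have shift: "vals s2 ''u'' h = ?u h - (if \<exists>j\<le>n. ?r j \<noteq> 0 \<and> ?p j = Suc h then d else 0)"
      "vals s2 ''w'' j = ?w j + (if j \<le> n \<and> ?r j \<noteq> 0 then d else 0)" for h j
  proof -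
    have inj: "i = j" if "i \<le> n" "j \<le> n" "?r i \<noteq> 0" "?r j \<noteq> 0" "?p i = ?p j" for i j
      using search_tree_inj[OF T that(1,2) nz[OF that(1,3)] that(5)] .
    note S = run_shift_prog[of s1, unfolded eq1, OF nz inj]
    show "vals s2 ''u'' h = ?u h - (if \<exists>j\<le>n. ?r j \<noteq> 0 \<and> ?p j = Suc h then d else 0)"
      "vals s2 ''w'' j = ?w j + (if j \<le> n \<and> ?r j \<noteq> 0 then d else 0)"
      unfolding s2_def d_def by (rule S; assumption)+
  qed
  let ?s = "run grow_prog s"
  have used: "nats ?s ''used'' = ?r(b := l + 2)" and way: "nats ?s ''way'' = ?y(b := c)"
    and out: "nats ?s ''out'' = ?p" and u: "vals ?s ''u'' = vals s2 ''u''" and w: "vals ?s ''w'' = vals s2 ''w''"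
    and fin: "nats ?s ''done'' 0 = (if ?p b = 0 then 1 else 0)" "?p b = 0 \<Longrightarrow> nats ?s ''cur'' 0 = b"
    by (simp_all add: grow_prog_def flip: s1_def s2_def,
        simp_all add: fr1 fr2 b_def[symmetric] c_def[symmetric] l active)
  have d: "d = ?u (?p c - 1) + ?w b - g b (?p c - 1)" using bc slack by simp
  have min: "d \<le> ?u (?p i - 1) + ?w j - g j (?p i - 1)" if "i \<le> n" "?r i \<noteq> 0" "j < n" "?r j = 0" for i j
  proof -
    have "d \<le> slack s i j" using best that unfolding best_edge_def by blast
    then show ?thesis using slack that by simp
  qed
  have w_shift: "vals s2 ''w'' j = ?w j + (if ?r j \<noteq> 0 then d else 0)" if "j < n" for j
    using shift(2)[of j] that by simp
  have grown: "search_tree k (Suc l) ?p (vals s2 ''u'') (vals s2 ''w'') (?r(b := l + 2)) (?y(b := c))"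
      "?p b \<noteq> 0 \<Longrightarrow> growing (Suc l) ?p (?r(b := l + 2))"
    by (rule search_tree_grow[OF T G bc(1-4) d];
        (rule min, assumption+ | rule k | rule shift(1) | rule w_shift, assumption | assumption))+
  show ?thesis
  proof (cases "?p b = 0")
    case True
    then show ?thesis
      unfolding tree_state_def used way out u w using grown(1) fin bc(1) by simp
  next
    case False
    then show ?thesis
      unfolding tree_state_def used way out u w using grown(1) grown(2)[OF False] fin by simp
  qed
qed

lemma tree_state_counter: "tree_state k l (nupdate ''l'' 0 x s) = tree_state k l s"
  by (simp add: tree_state_def)

lemma run_tree_prog:
  assumes load: "loaded s" and match: "matching_state k s" and k: "nats s ''k'' 0 = k" "k < m"
  shows "tree_state k n (run tree_prog s)"
proof -
  define s1 where "s1 = run (LFor ''j'' ''n'' 0 (LNat ''used'' (NVar ''j'') (NConst 0))) s"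
  define s2 where "s2 = nupdate ''done'' 0 0 (nupdate ''out'' n (Suc k) (nupdate ''used'' n 1 s1))"
  have n: "nats s ''n'' 0 = n" using load by (simp add: loaded_def)
  have fr1: "nats s1 y = nats s y" if "y \<noteq> ''j''" "y \<noteq> ''used''" for y
    unfolding s1_def using that by (intro nats_run) simp
  have fv1: "vals s1 y = vals s y" for y
    unfolding s1_def by (intro vals_run) simp
  have used1: "\<forall>j<n. nats s1 ''used'' j = 0"
  proof -
    let ?I = "\<lambda>k s'. \<forall>j<k. nats s' ''used'' j = 0"
    have "?I (nats s ''n'' 0 + 0) s1"
      unfolding s1_def by (rule run_LFor[where I = ?I]) (auto simp: less_Suc_eq)
    then show ?thesis by (simp add: n)
  qed
  have "matching k ((nats s ''out'')(n := Suc k)) (vals s ''u'') (vals s ''w'')"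
    using match by (rule matching_fun_upd)
  then have "tree_state k 0 s2"
    using search_tree_start[of k "(nats s ''out'')(n := Suc k)" "vals s ''u''" "vals s ''w''" "(nats s1 ''used'')(n := 1)"] used1
    by (simp add: tree_state_def s2_def fr1 fv1)
  have eq: "run tree_prog s = run (LFor ''l'' ''n'' 0 (LCond (NLess (NVar ''done'') (NConst 1)) grow_prog LSkip)) s2"
    by (simp add: tree_prog_def s2_def fr1 n k Suc_eq_plus1 flip: s1_def del: run.simps(6))
  let ?I = "\<lambda>l s'. tree_state k l s'"
  have load2: "loaded s2" by (rule loaded_frame[OF load]) (simp_all add: s2_def fr1 fv1)
  have "?I (nats s2 ''n'' 0 + 0) (run tree_prog s)"
    unfolding eq
  proof (rule run_LFor[where I = ?I], goal_cases)
    case 3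
    then show ?case using \<open>tree_state k 0 s2\<close> by (simp add: tree_state_def)
  next
    case (4 l s')
    have load': "loaded s'"
      by (rule loaded_frame[OF load2]) (rule 4, simp add: prog_defs)+
    have "tree_state k (Suc l) (if nats s' ''done'' 0 < 1 then run grow_prog s' else s')"
    proof (cases "nats s' ''done'' 0 = 0")
      case True
      then show ?thesis using run_grow_prog[OF load' 4(5) True 4(2) _ k(2)] 4(1) load2
        by (simp add: loaded_def)
    next
      case False
      \<comment> \<open>An idle round merely relaxes the upper bound on ranks.\<close>
      then show ?thesis using 4(5) by (simp add: tree_state_def search_tree_def le_SucI)
    qed
    then show ?case by (auto simp: tree_state_counter split: if_splits)
  qed (simp_all add: prog_defs)
  then show ?thesis using load2 by (simp add: loaded_def)
qed

lemma run_augment_prog: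
  assumes load: "loaded s" and tree: "tree_state k n s" and k: "k < n"
  shows "matching_state (Suc k) (run augment_prog s)"
proof -
  let ?p = "nats s ''out''" and ?u = "vals s ''u''" and ?w = "vals s ''w''"
  let ?r = "nats s ''used''" and ?y = "nats s ''way''"
  have n: "nats s ''n'' 0 = n" using load by (simp add: loaded_def)
  have T: "search_tree k n ?p ?u ?w ?r ?y" using tree by (simp add: tree_state_def)
  \<comment> \<open>The \<open>n\<close> rounds must have succeeded, by the pigeonhole
    argument.\<close>
  have "nats s ''done'' 0 \<noteq> 0" using not_growing_full[OF T _ k] tree by (auto simp: tree_state_def)
  then have start: "augmenting k 0 ?p ?p (nats s ''cur'' 0) ?u ?w ?r"
    using augmenting_start[OF T] tree by (simp add: tree_state_def)
  let ?I = "\<lambda>t s'. augmenting k t (nats s' ''out'') ?p (nats s' ''cur'' 0) ?u ?w ?r"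
  have "?I (nats s ''n'' 0 + 0) (run augment_prog s)"
    unfolding augment_prog_def
  proof (rule run_LFor[where I = ?I], goal_cases)
    case 3
    then show ?case using start by simp
  next
    case (4 t s')
    have fr: "nats s' ''n'' = nats s ''n''" "nats s' ''way'' = nats s ''way''" by (rule 4; simp)+
    show ?case
    proof (cases "nats s' ''cur'' 0 = n")
      case True
      \<comment> \<open>Once the vacancy is at the root, the alternative \<open>c = n\<close> in
        \<open>augmenting\<close> lets \<open>t\<close> increase without a move.\<close>
      then show ?thesis using 4(5) by (simp add: fr n augmenting_def)
    next
      case False
      then have "nats s' ''cur'' 0 < n" using 4(5) by (simp add: augmenting_def)
      then show ?thesis using augmenting_step[OF T 4(5) False] by (simp add: fr n)
    qed
  qed simp_all
  then have "matching (Suc k) (nats (run augment_prog s) ''out'') ?u ?w"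
    using augmenting_finish(2)[OF T] by (simp add: n)
  then show ?thesis by (simp add: vals_run augment_prog_def del: run.simps)
qed

lemma run_phases:
  assumes load: "loaded s" and match: "matching_state 0 s" and mn: "m \<le> n"
  shows "matching_state m (run (LFor ''k'' ''m'' 0 (LSeq tree_prog augment_prog)) s)"
proof -
  let ?I = "\<lambda>k s'. matching_state k s'"
  have m: "nats s ''m'' 0 = m" using load by (simp add: loaded_def)
  have "?I (nats s ''m'' 0 + 0) (run (LFor ''k'' ''m'' 0 (LSeq tree_prog augment_prog)) s)"
  proof (rule run_LFor[where I = ?I], goal_cases)
    case 3
    then show ?case using match by simp
  next
    case (4 k s')
    have load': "loaded s'"
      by (rule loaded_frame[OF load]) (rule 4, simp add: prog_defs)+
    have load'': "loaded (run tree_prog s')"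
      by (rule loaded_frame[OF load']) (simp_all add: nats_run vals_run prog_defs del: run.simps)
    have k: "k < m" using 4(1) m by simp
    have "matching_state (Suc k) (run augment_prog (run tree_prog s'))"
      using run_augment_prog[OF load'' run_tree_prog[OF load' 4(5,2) k]] k mn by simp
    then show ?case by simp
  qed (simp_all add: prog_defs)
  then show ?thesis by (simp add: m)
qed

end

lemma run_main_prog:
  fixes n m :: nat
  assumes mn: "m \<le> n" and v: "\<forall>i<n. \<forall>h<m. 0 \<le> v i h"
  shows "is_arg_min (total_envy {..<n} v) (complete_allocation {..<n} {..<m})
    (output_allocation (run main_prog (input_state n m v)))"
proof -
  let ?g = "\<lambda>i h. \<Sum>h'<m. min (v i h) (v i h')"
  define s0 where "s0 = input_state n m v"
  define s1 where "s1 = run offset_prog s0"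
  define s2 where "s2 = run weight_prog s1"
  have fr1: "nats s1 y = nats s0 y" if "y \<notin> {''i'', ''offset''}" for y
    unfolding s1_def using that by (intro nats_run) (simp add: offset_prog_def)
  have fv1: "vals s1 y = vals s0 y" for y
    unfolding s1_def by (intro vals_run) (simp add: offset_prog_def)
  have fr2: "nats s2 y = nats s1 y" if "y \<notin> {''i'', ''h'', ''g''}" for y
    unfolding s2_def using that by (intro nats_run) (simp add: weight_prog_def row_prog_def min_sum_prog_def)
  have fv2: "vals s2 y = vals s1 y" if "y \<notin> {''acc'', ''u'', ''G''}" for y
    unfolding s2_def using that by (intro vals_run) (simp add: weight_prog_def row_prog_def min_sum_prog_def)
  have nm: "nats s0 ''n'' 0 = n" "nats s0 ''m'' 0 = m" by (simp_all add: s0_def input_state_def)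
  have off: "\<forall>i\<le>n. nats s1 ''offset'' i = i * m"
    using run_offset_prog[of s0] nm by (simp add: s1_def s0_def input_state_def)
  have vs: "\<forall>i<n. \<forall>h<m. vals s1 ''v'' (i * m + h) = v i h"
  proof (intro allI impI)
    fix i h assume ih: "i < n" "h < m"
    have "i * m + h < Suc i * m" using ih by simp
    also have "\<dots> \<le> n * m" using ih by (intro mult_right_mono) auto
    finally show "vals s1 ''v'' (i * m + h) = v i h"
      using ih by (simp add: fv1 s0_def input_state_def)
  qed
  have W: "\<forall>i<n. \<forall>h<m. vals s2 ''G'' (i * m + h) = ?g i h"
      "\<forall>h<m. vals s2 ''u'' h = (\<Sum>i<n. ?g i h)"
    unfolding s2_def
    by (rule run_weight_prog; use nm off vs in \<open>simp add: fr1 fv1 s0_def input_state_def\<close>)+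
  have load: "weights.loaded n m ?g s2"
    using W(1) nm off by (simp add: weights.loaded_def fr2 fr1)
  \<comment> \<open>These arrays have not been written; the zeros of the initial memory serve as the
    empty matching and as the initial \<open>w\<close>.\<close>
  have w0: "vals s2 ''w'' i = 0" and out0: "nats s2 ''out'' i = 0" for i
    by (simp_all add: fr2 fv2 fr1 fv1 s0_def input_state_def)
  \<comment> \<open>Valuations are nonnegative, hence so are the weights, and a single term is at
    most the column sum.\<close>
  have "?g i h \<le> vals s2 ''u'' h" if "i < n" "h < m" for i h
  proof -
    have "?g i h \<le> (\<Sum>i<n. ?g i h)"
      using that v by (intro member_le_sum) (auto intro!: sum_nonneg)
    then show ?thesis using W(2) that by simp
  qed
  then have "weights.matching n m ?g 0 (nats s2 ''out'') (vals s2 ''u'') (vals s2 ''w'')"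
    by (simp add: weights.matching_def weights.feasible_def w0 out0)
  from weights.run_phases[OF load this mn] matching_optimal[OF mn v]
  show ?thesis by (simp add: main_prog_def s2_def s1_def s0_def del: run.simps(6))
qed

lemma compile_main_prog_exec:
  "\<exists>P :: nat poly. \<forall>s N. nats s ''n'' 0 \<le> N \<longrightarrow> nats s ''m'' 0 \<le> N \<longrightarrow>
    (\<exists>t\<le>poly P N. unit_exec (compile main_prog) s t (run main_prog s))"
  by (rule compile_exec) (simp_all add: prog_defs)

section \<open>Size of the input\<close>

lemma rational_fraction_bits:
  assumes "x \<in> \<rat>"
  shows "\<exists>(a::int) (b::nat). 0 < b \<and> x * real b = of_int a \<and> \<bar>a\<bar> \<le> 2 ^ real_bits x \<and> b \<le> 2 ^ real_bits x"
proof -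
  obtain r where r: "x = of_rat r" using assms by (rule Rats_cases)
  then have inv: "inv (of_rat :: rat \<Rightarrow> real) x = r" by (simp add: inv_f_f inj_on_def)
  obtain a b where q: "quotient_of r = (a, b)" by fastforce
  have b: "b > 0" "r = of_int a / of_int b" using quotient_of_denom_pos[OF q] quotient_of_div[OF q] by auto
  have bits: "real_bits x = 1 + nat_bits (nat \<bar>a\<bar>) + nat_bits (nat b)"
    by (simp add: real_bits_def inv rat_bits_def q)
  have less: "k < 2 ^ nat_bits k" for k
    using floorlog_le_iff[of 2 k "nat_bits k"] by (simp add: nat_bits_def)
  have "nat \<bar>a\<bar> < 2 ^ real_bits x"
    by (rule less_power2_mono[OF less]) (simp add: bits)
  then have "int (nat \<bar>a\<bar>) < int (2 ^ real_bits x)" by (simp only: of_nat_less_iff)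
  then have "\<bar>a\<bar> \<le> 2 ^ real_bits x" by simp
  moreover have "nat b < 2 ^ real_bits x"
    by (rule less_power2_mono[OF less]) (simp add: bits)
  moreover have "x * real (nat b) = of_int a"
    using b r by (simp add: of_rat_divide)
  ultimately show ?thesis using b(1) by (intro exI[of _ a] exI[of _ "nat b"]) simp
qed

text \<open>\<open>D\<close> is the product of the denominators, so its bit length is at most the
  sum of the input sizes. Over \<open>D\<close>, a numerator is multiplied by the other denominators
  only, so the same exponent bounds it.\<close>

lemma common_denominator:
  assumes "finite I" "\<forall>i\<in>I. x i \<in> \<rat>"
  shows "\<exists>D>0. D \<le> 2 ^ (\<Sum>i\<in>I. real_bits (x i)) \<and>
    (\<forall>i\<in>I. represented D (\<Sum>i\<in>I. real_bits (x i)) (x i))"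
  using assms
proof (induction I rule: finite_induct)
  case empty
  show ?case by (intro exI[of _ 1]) simp
next
  case (insert j I)
  let ?S = "\<Sum>i\<in>I. real_bits (x i)"
  obtain D where D: "0 < D" "D \<le> 2 ^ ?S" "\<forall>i\<in>I. represented D ?S (x i)" using insert by auto
  obtain a b where ab: "0 < b" "x j * real b = of_int a" "\<bar>a\<bar> \<le> 2 ^ real_bits (x j)" "b \<le> 2 ^ real_bits (x j)"
    using rational_fraction_bits insert.prems by blast
  have S: "(\<Sum>i\<in>insert j I. real_bits (x i)) = real_bits (x j) + ?S" using insert by simp
  have "represented (b * D) (real_bits (x j) + ?S) (x i)" if i: "i \<in> insert j I" for i
  proof (cases "i = j")
    case True
    have "int D \<le> int (2 ^ ?S)" using D(2) by (simp only: of_nat_le_iff)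
    then have "\<bar>a\<bar> * int D \<le> 2 ^ real_bits (x j) * 2 ^ ?S" using ab(3) by (intro mult_mono) simp_all
    moreover have "x i * real (b * D) = of_int (a * int D)"
      using ab(2) True by (simp add: mult.assoc[symmetric])
    ultimately show ?thesis
      unfolding represented_def by (intro exI[of _ "a * int D"] conjI) (simp_all add: power_add abs_mult)
  next
    case False
    then obtain z where z: "x i * real D = of_int z" "\<bar>z\<bar> \<le> 2 ^ ?S"
      using D(3) i by (auto simp: represented_def)
    have "int b \<le> int (2 ^ real_bits (x j))" using ab(4) by (simp only: of_nat_le_iff)
    then have "int b * \<bar>z\<bar> \<le> 2 ^ real_bits (x j) * 2 ^ ?S" using z(2) by (intro mult_mono) simp_all
    moreover have "x i * real (b * D) = of_int (int b * z)"
      using z(1) by (simp add: mult.left_commute)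
    ultimately show ?thesis
      unfolding represented_def by (intro exI[of _ "int b * z"] conjI) (simp_all add: power_add abs_mult)
  qed
  moreover have "b * D \<le> 2 ^ (real_bits (x j) + ?S)"
    using ab(4) D(2) by (simp add: power_add mult_mono)
  ultimately show ?case
    unfolding S using ab(1) D(1) by (intro exI[of _ "b * D"]) simp
qed

lemma input_state_bound:
  assumes "\<forall>i<n. \<forall>h<m. v i h \<in> \<rat>"
  shows "\<exists>D>0. D \<le> 2 ^ input_bits n m v \<and> state_bound D (input_bits n m v) (input_state n m v)"
proof -
  let ?S = "\<Sum>x\<in>{..<n} \<times> {..<m}. real_bits (v (fst x) (snd x))"
  have I: "input_bits n m v = n + m + ?S"
    by (simp add: input_bits_def sum.cartesian_product case_prod_beta)
  obtain D where D: "0 < D" "D \<le> 2 ^ ?S" "\<forall>x\<in>{..<n} \<times> {..<m}. represented D ?S (v (fst x) (snd x))"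
    using common_denominator[of "{..<n} \<times> {..<m}" "\<lambda>x. v (fst x) (snd x)"] assms by auto
  have "D \<le> 2 ^ input_bits n m v"
    using D(2) by (rule order_trans) (simp add: I power_increasing)
  moreover have "state_bound D (input_bits n m v) (input_state n m v)"
    unfolding state_bound_def
  proof (intro conjI allI)
    fix x k
    \<comment> \<open>The unary part \<open>n + m\<close> of the input size is more than enough to
      bound \<open>n\<close> and \<open>m\<close> themselves.\<close>
    have "n < 2 ^ input_bits n m v" "m < 2 ^ input_bits n m v"
      by (rule less_power2_mono[OF less_exp]; simp add: I)+
    then show "nats (input_state n m v) x k < 2 ^ input_bits n m v"
      by (simp add: input_state_def)
    show "represented D (input_bits n m v) (vals (input_state n m v) x k)"
    proof (cases "x = ''v'' \<and> k < n * m")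
      case True
      then have "m > 0" by (cases m) auto
      then have "k div m < n" "k mod m < m" using True by (simp_all add: less_mult_imp_div_less)
      then have "represented D ?S (v (k div m) (k mod m))" using D(3) by auto
      then show ?thesis using True by (auto simp: input_state_def I intro: represented_mono)
    next
      case False
      then show ?thesis by (auto simp: input_state_def represented_def intro!: exI[of _ 0])
    qed
  qed
  ultimately show ?thesis using D(1) by blast
qed

theorem corollary4p4:
  shows "\<exists>prog :: com. \<exists>p q :: nat poly.
    \<forall>(n :: nat) (m :: nat) (v :: nat \<Rightarrow> nat \<Rightarrow> real).
      m \<le> n \<longrightarrow> (\<forall>i<n. \<forall>h<m. 0 \<le> v i h) \<longrightarrow>
      (\<exists>s. is_arg_min (total_envy {..<n} v) (complete_allocation {..<n} {..<m})
              (output_allocation s) \<and>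
           (\<exists>t \<le> poly p (n + m). arith_exec prog (input_state n m v) t s) \<and>
           ((\<forall>i<n. \<forall>h<m. v i h \<in> \<rat>) \<longrightarrow>
              (\<exists>t \<le> poly q (input_bits n m v). bit_exec prog (input_state n m v) t s)))"
proof -
  obtain P :: "nat poly" where P: "nats s ''n'' 0 \<le> N \<Longrightarrow> nats s ''m'' 0 \<le> N \<Longrightarrow>
      \<exists>t\<le>poly P N. unit_exec (compile main_prog) s t (run main_prog s)" for s N
    using compile_main_prog_exec by auto
  obtain K where K: "com_bound K (compile main_prog)" using com_bound_exists by blast
  \<comment> \<open>This is \<open>t * (2 * M + 5)\<close> with \<open>P\<close> in place of
    \<open>t\<close> and \<open>M\<close> equal to the input size plus \<open>K\<close> plus
    \<open>t\<close>.\<close>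
  define q where "q = P * ([:2 * K + 5, 2:] + smult 2 P)"
  have bits: "\<exists>t \<le> poly q (input_bits n m v). bit_exec (compile main_prog) (input_state n m v) t s"
    if t: "t \<le> poly P (n + m)" "unit_exec (compile main_prog) (input_state n m v) t s"
      and rat: "\<forall>i<n. \<forall>h<m. v i h \<in> \<rat>" for n m v t s
  proof -
    let ?I = "input_bits n m v"
    obtain D where D: "0 < D" "D \<le> 2 ^ ?I" "state_bound D ?I (input_state n m v)"
      using input_state_bound[OF rat] by blast
    have le: "t \<le> poly P ?I"
      using t(1) nat_poly_mono[of "n + m" ?I P] by (simp add: input_bits_def)
    \<comment> \<open>The input size accounts for the initial memory, \<open>K\<close> for the
      constants of the program and \<open>t\<close> for the growth during the run.\<close>
    let ?M = "?I + K + t"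
    have "(2::nat) ^ ?I < 2 ^ Suc ?M" by (intro power_strict_increasing) simp_all
    with D(2) have "D < 2 ^ Suc ?M" by (rule le_less_trans)
    moreover have "state_bound D (?I + K) (input_state n m v)" by (rule state_bound_mono[OF D(3)]) simp
    moreover have "com_bound (?I + K) (compile main_prog)" by (rule com_bound_mono[OF K]) simp
    ultimately obtain t' where t': "t' \<le> t * (2 * ?M + 5)"
        "exec nat_bits real_bits (compile main_prog) (input_state n m v) t' s"
      using bit_exec_of_unit_exec[OF t(2) _ _ _ D(1), of "?I + K" ?M] by auto
    have "t * (2 * ?M + 5) \<le> poly P ?I * (2 * (?I + K + poly P ?I) + 5)"
      using le by (intro mult_mono) simp_all
    also have "\<dots> = poly q ?I" by (simp add: q_def algebra_simps)
    finally show ?thesis using t' unfolding bit_exec_def by (meson order_trans)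
  qed
  show ?thesis
  proof (rule exI[of _ "compile main_prog"], rule exI[of _ P], rule exI[of _ q], intro allI impI)
    fix n m :: nat and v :: "nat \<Rightarrow> nat \<Rightarrow> real"
    assume mn: "m \<le> n" and v: "\<forall>i<n. \<forall>h<m. 0 \<le> v i h"
    let ?s = "run main_prog (input_state n m v)"
    have "\<exists>t\<le>poly P (n + m). unit_exec (compile main_prog) (input_state n m v) t ?s"
      by (rule P) (simp_all add: input_state_def)
    then obtain t where t: "t \<le> poly P (n + m)" "unit_exec (compile main_prog) (input_state n m v) t ?s"
      by blast
    show "\<exists>s. is_arg_min (total_envy {..<n} v) (complete_allocation {..<n} {..<m}) (output_allocation s) \<and>
           (\<exists>t \<le> poly P (n + m). arith_exec (compile main_prog) (input_state n m v) t s) \<and>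
           ((\<forall>i<n. \<forall>h<m. v i h \<in> \<rat>) \<longrightarrow>
              (\<exists>t \<le> poly q (input_bits n m v). bit_exec (compile main_prog) (input_state n m v) t s))"
      using t bits[OF t] run_main_prog[OF mn v] unfolding arith_exec_def by (intro exI[of _ ?s]) auto
  qed
qed

end
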